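(* Fix $n$. Let $G_\infty$ denote the inductive limit of a chain $G_k\subset G_{k+1}\subset\cdots$ of compact groups. Let $R_{G_\infty}$ and $R'_{(G'_n)_\infty}$ be given dual representations, of $G_\infty$ and of a group $G'_n$ respectively, on $\mathcal{F}_{n\times\infty}$. Let $H_\infty$ denote the inductive limit of a chain of compact subgroups $H_k\subset H_{k+1}\subset\cdots$ such that $H_k\subset G_k$ for all $k$. Let $R_{H_\infty}$ be the representation of $H_\infty$ on $\mathcal{F}_{n\times\infty}$ obtained by restricting $R_{G_\infty}$ to $H_\infty$. Suppose there exist a group $H'_n\supset G'_n$ and a representation $R'_{(H'_n)_\infty}$ of $H'_n$ on $\mathcal{F}_{n\times\infty}$ such that $R'_{(H'_n)_\infty}$ is dual to $R_{H_\infty}$ and $R'_{(G'_n)_\infty}$ is the restriction of $R'_{(H'_n)_\infty}$ to the subgroup $G'_n$ of $H'_n$. Then we have the following multiplicity-free decompositions of $\mathcal{F}_{n\times\infty}$ into isotypic components: $$\mathcal{F}_{n\times\infty}=\bigoplus_{(\lambda)}\mathcal{I}^{(\lambda)}_{n\times\infty}=\bigoplus_{(\mu)}\mathcal{I}^{(\mu)}_{n\times\infty},$$ where $(\lambda)$ is a common irreducible signature of the pair $(G'_n,G_\infty)$ and $(\mu)$ is a common irreducible signature of the pair $(H'_n,H_\infty)$. Moreover, if $\lambda_{G_\infty}$ (resp. $\lambda'_{(G'_n)_\infty}$) denotes an irreducible unitary representation of $G_\infty$ (resp. $G'_n$) of class $(\lambda)$, and $\mu_{H_\infty}$ (resp.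 $\mu'_{(H'_n)_\infty}$) denotes an irreducible unitary representation of $H_\infty$ (resp. $H'_n$) of class $(\mu)$, then the multiplicity $$\dim\left[\operatorname{Hom}_{H_\infty}\left(\mu_{H_\infty}:\lambda_{G_\infty}|_{H_\infty}\right)\right]$$ of the irreducible representation $\mu_{H_\infty}$ in the restriction to $H_\infty$ of the representation $\lambda_{G_\infty}$ is equal to the multiplicity $$\dim\left[\operatorname{Hom}_{G'_n}\left(\lambda'_{(G'_n)_\infty}:\mu'_{(H'_n)_\infty}|_{G'_n}\right)\right]$$ of the irreducible representation $\lambda'_{(G'_n)_\infty}$ in the restriction to $G'_n$ of the representation $\mu'_{(H'_n)_\infty}$.
   Context: For positive integers $n,k$, let $\mathbb{C}^{n\times k}$ be the space of complex $n\times k$ matrices with the Gaussian measure $d\mu(Z)=\pi^{-nk}\exp[-\operatorname{Tr}(ZZ^\dagger)]\,dZ$, where $Z^\dagger$ is the adjoint of $Z$ and $dZ$ is Lebesgue measure. The Bargmann--Segal--Fock space $\mathcal{F}_{n\times k}$ is the Hilbert space of entire holomorphic functions on $\mathbb{C}^{n\times k}$ that are square-integrable with respect to this measure, with inner product $(f|g)=\int f\,\overline{g}\,d\mu$. A function of the first $k$ columns is regarded as a function on $\mathbb{C}^{n\times(k+1)}$; this gives an isometric embedding $\mathcal{F}_{n\times k}\to\mathcal{F}_{n\times(k+1)}$. For fixed $n$, $\mathcal{F}_{n\times\infty}$ is the Hilbert-space completion of the inductive limit $\bigcup_{k}\mathcal{F}_{n\times k}$ (taken over $k>2n$). The groups $G_k$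 are subgroups of $\mathrm{GL}_k(\mathbb{C})$, with $G_k$ naturally embedded in $G_{k+1}$ via $g\mapsto\begin{pmatrix} g&0\\0&1\end{pmatrix}$, and $G_\infty=\bigcup_k G_k$; similarly $H_\infty=\bigcup_k H_k$. The groups $G'_n$ and $H'_n$ are topological groups. Dual representations. Let $G$ and $G'$ be topological groups, and let $R_G$ and $R'_{G'}$ be continuous unitary, completely (discretely) reducible representations of $G$ and $G'$ on a Fock space $\mathcal{F}$ such that $R_G$ and $R'_{G'}$ commute. They are called dual if the $G'\times G$-module $\mathcal{F}$ decomposes into a multiplicity-free orthogonal (Hilbert) direct sum $\mathcal{F}=\bigoplus_{(\lambda)}\mathcal{I}^{(\lambda)}$, where: (i) the label $(\lambda)$ (called a common irreducible signature of the pair $(G',G)$) characterizes both an equivalence class of an irreducible unitary representation $\lambda_G$ of $G$ and an equivalence class of an irreducible unitary representation $\lambda'_{G'}$ of $G'$; (ii) $\mathcal{I}^{(\lambda)}$ is the $(\lambda)$-isotypic component, i.e. the direct sum of all irreducible subrepresentations of $R_G$ belonging to the class $\lambda_G$, and is likewise the direct sum of all irreducible subrepresentations of $R'_{G'}$ belonging to the class $\lambda'_{G'}$; (iii) each $\mathcal{I}^{(\lambda)}$ is an irreducible $G'\times G$-module, isomorphic to the Hilbert-space tensor product $V^{(\lambda_G)}\,\hat\otimes\,W^{(\lambda'_{G'})}$, where $V^{(\lambda_G)}$ is an irreducible $G$-module of class $\lambda_G$ and $W^{(\lambda'_{G'})}$ is an irreducible $G'$-module of class $\lambda'_{G'}$.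 In the claim this definition is used with $\mathcal{F}=\mathcal{F}_{n\times\infty}$ and with the pairs $(G'_n,G_\infty)$ and $(H'_n,H_\infty)$, and the corresponding isotypic components are denoted $\mathcal{I}^{(\lambda)}_{n\times\infty}$ and $\mathcal{I}^{(\mu)}_{n\times\infty}$. The subscript $\infty$ in $R'_{(G'_n)_\infty}$ and similar symbols only records that the representation space is $\mathcal{F}_{n\times\infty}$; the group acting is $G'_n$ (resp. $H'_n$). For unitary representations $\rho,\sigma$ of a group $K$, $\operatorname{Hom}_K(\rho:\sigma)$ is the vector space of (continuous) linear maps from the space of $\rho$ to the space of $\sigma$ that intertwine the actions of $K$. *)

theory Defs
  imports
    "HOL-Analysis.Analysis"
    "HOL-Library.Function_Algebras"
    "HOL-Library.Groups_Big_Fun"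
    "Jordan_Normal_Form.Schur_Decomposition"
begin

unbundle cardinal_syntax

section \<open>Complex Hilbert spaces\<close>

class complex_vector = ab_group_add +
  fixes scaleC :: "complex \<Rightarrow> 'a \<Rightarrow> 'a"  (infixr \<open>*\<^sub>C\<close> 75)
  assumes scaleC_add_right: "a *\<^sub>C (x + y) = a *\<^sub>C x + a *\<^sub>C y"
    and scaleC_add_left: "(a + b) *\<^sub>C x = a *\<^sub>C x + b *\<^sub>C x"
    and scaleC_scaleC [simp]: "a *\<^sub>C b *\<^sub>C x = (a * b) *\<^sub>C x"
    and scaleC_one [simp]: "1 *\<^sub>C x = x"

global_interpretation complex_vector:
  vector_space "scaleC :: complex \<Rightarrow> 'a \<Rightarrow> 'a :: complex_vector"
  defines cdependent_raw_def: cdependent = complex_vector.dependent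
    and csubspace_raw_def: csubspace = complex_vector.subspace
    and cspan_raw_def: cspan = complex_vector.span
  by unfold_locales (simp_all add: scaleC_add_right scaleC_add_left)

instantiation complex :: complex_vector
begin
definition scaleC_complex_def: "scaleC = ((*) :: complex \<Rightarrow> complex \<Rightarrow> complex)"
instance by standard (simp_all add: scaleC_complex_def algebra_simps)
end

instantiation "fun" :: (type, complex_vector) complex_vector
begin
definition scaleC_fun_def: "c *\<^sub>C f = (\<lambda>x. c *\<^sub>C f x)"
instance
  by standard (simp_all add: scaleC_fun_def fun_eq_iff scaleC_add_right scaleC_add_left)
end

text \<open>The complex inner product is linear in its first argument. Its real part is the real inner
  product inherited from \<^class>\<open>real_inner\<close>, so norm, metric and topology are those of the
  library.\<close>

class complex_inner = complex_vector + real_inner +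
  fixes cinner :: "'a \<Rightarrow> 'a \<Rightarrow> complex"
  assumes scaleR_scaleC: "r *\<^sub>R x = complex_of_real r *\<^sub>C x"
    and cinner_commute: "cinner x y = cnj (cinner y x)"
    and cinner_add_left: "cinner (x + y) z = cinner x z + cinner y z"
    and cinner_scaleC_left: "cinner (c *\<^sub>C x) y = c * cinner x y"
    and inner_eq_Re_cinner: "inner x y = Re (cinner x y)"

class chilbert_space = complex_inner + complete_space

instantiation complex :: chilbert_space
begin
definition cinner_complex_def: "cinner x y = x * cnj y" for x y :: complex
instance
  by standard
    (simp_all add: cinner_complex_def scaleC_complex_def inner_complex_def scaleR_conv_of_real
      algebra_simps)
end

definition clinear_on :: "'a::complex_vector set \<Rightarrow> ('a \<Rightarrow> 'b::complex_vector) \<Rightarrow> bool" where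
  "clinear_on S T \<longleftrightarrow>
     (\<forall>x\<in>S. \<forall>y\<in>S. T (x + y) = T x + T y) \<and> (\<forall>c. \<forall>x\<in>S. T (c *\<^sub>C x) = c *\<^sub>C T x)"

definition closed_csubspace :: "'a::complex_inner set \<Rightarrow> bool" where
  "closed_csubspace S \<longleftrightarrow> csubspace S \<and> closed S"

text \<open>Unitary map from \<open>S\<close> onto \<open>T\<close>.\<close>

definition unitary_map :: "'a::complex_inner set \<Rightarrow> 'b::complex_inner set \<Rightarrow> ('a \<Rightarrow> 'b) \<Rightarrow> bool" where
  "unitary_map S T U \<longleftrightarrow> bij_betw U S T \<and> clinear_on S U \<and>
     (\<forall>x\<in>S. \<forall>y\<in>S. cinner (U x) (U y) = cinner x y)"

definition hilbert_direct_sum :: "'a::complex_inner set \<Rightarrow> 'i set \<Rightarrow> ('i \<Rightarrow> 'a set) \<Rightarrow> bool" where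
  "hilbert_direct_sum S \<Lambda> I \<longleftrightarrow>
     (\<forall>l\<in>\<Lambda>. closed_csubspace (I l)) \<and>
     (\<forall>l\<in>\<Lambda>. \<forall>m\<in>\<Lambda>. l \<noteq> m \<longrightarrow> (\<forall>x\<in>I l. \<forall>y\<in>I m. cinner x y = 0)) \<and>
     closure (cspan (\<Union>l\<in>\<Lambda>. I l)) = S"

text \<open>\<open>S\<close> together with \<open>\<tau> v w\<close> in the role of \<open>v \<otimes> w\<close> is the Hilbert-space tensor product of
  \<open>V\<close> and \<open>W\<close>. The inner product formula makes it unique up to a unitary map that respects
  elementary tensors.\<close>

definition hilbert_tensor_product ::
  "'a::complex_inner set \<Rightarrow> 'b::complex_inner set \<Rightarrow> 'c::complex_inner set
     \<Rightarrow> ('a \<Rightarrow> 'b \<Rightarrow> 'c) \<Rightarrow> bool" where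
  "hilbert_tensor_product V W S \<tau> \<longleftrightarrow>
     (\<forall>w\<in>W. clinear_on V (\<lambda>v. \<tau> v w)) \<and> (\<forall>v\<in>V. clinear_on W (\<tau> v)) \<and>
     (\<forall>v\<in>V. \<forall>w\<in>W. \<forall>v'\<in>V. \<forall>w'\<in>W. cinner (\<tau> v w) (\<tau> v' w') = cinner v v' * cinner w w') \<and>
     closure (cspan {\<tau> v w | v w. v \<in> V \<and> w \<in> W}) = S"

text \<open>The dimension of a complex vector space as a cardinal: the cardinality of a Hamel basis.
  Unlike the \<^typ>\<open>nat\<close>-valued dimension of \<^locale>\<open>vector_space\<close> it does not identify infinite
  dimensions with \<open>0\<close>. Dimensions are to be compared with \<open>=o\<close>.\<close>

definition cdim :: "'a::complex_vector set \<Rightarrow> 'a rel" where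
  "cdim S = |SOME B. B \<subseteq> S \<and> \<not> cdependent B \<and> S \<subseteq> cspan B|"


section \<open>The Bargmann--Segal--Fock spaces\<close>

definition mat_trace :: "complex mat \<Rightarrow> complex" where
  "mat_trace A = (\<Sum>i<dim_row A. A $$ (i, i))"

definition mat_norm :: "complex mat \<Rightarrow> real" where
  "mat_norm Z = sqrt (Re (mat_trace (Z * mat_adjoint Z)))"

text \<open>\<open>f\<close> is complex differentiable at every point of the space of \<open>n \<times> k\<close> matrices; the matrix
  \<open>D\<close> collects the partial derivatives.\<close>

definition entire_on_mat :: "nat \<Rightarrow> nat \<Rightarrow> (complex mat \<Rightarrow> complex) \<Rightarrow> bool" where
  "entire_on_mat n k f \<longleftrightarrow>
     (\<forall>Z\<in>carrier_mat n k. \<exists>D\<in>carrier_mat n k. \<forall>e>0. \<exists>d>0. \<forall>W\<in>carrier_mat n k.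
        mat_norm (W - Z) < d \<longrightarrow>
        cmod (f W - f Z - (\<Sum>i<n. \<Sum>j<k. D $$ (i, j) * (W - Z) $$ (i, j))) \<le> e * mat_norm (W - Z))"

text \<open>The Gaussian measure, carried by the families of entries: \<open>Matrix.mat n k x\<close> is the matrix with
  entries \<open>x (i, j)\<close>, and \<open>lborel\<close> is Lebesgue measure on the complex plane.\<close>

definition gaussian_measure :: "nat \<Rightarrow> nat \<Rightarrow> (nat \<times> nat \<Rightarrow> complex) measure" where
  "gaussian_measure n k =
     density (Pi\<^sub>M ({..<n} \<times> {..<k}) (\<lambda>_. lborel))
       (\<lambda>x. let Z = Matrix.mat n k x in
          ennreal (exp (- Re (mat_trace (Z * mat_adjoint Z))) / pi ^ (n * k)))"

text \<open>Functions on \<open>n \<times> k\<close> matrices are represented by functions that vanish off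
  \<^term>\<open>carrier_mat n k\<close>, so that equality of functions is equality on \<^term>\<open>carrier_mat n k\<close>.\<close>

definition fock_space :: "nat \<Rightarrow> nat \<Rightarrow> (complex mat \<Rightarrow> complex) set" where
  "fock_space n k =
     {f. entire_on_mat n k f \<and>
         integrable (gaussian_measure n k) (\<lambda>x. (cmod (f (Matrix.mat n k x)))\<^sup>2) \<and>
         (\<forall>Z. Z \<notin> carrier_mat n k \<longrightarrow> f Z = 0)}"

definition fock_inner ::
  "nat \<Rightarrow> nat \<Rightarrow> (complex mat \<Rightarrow> complex) \<Rightarrow> (complex mat \<Rightarrow> complex) \<Rightarrow> complex" where
  "fock_inner n k f g =
     (LINT x | gaussian_measure n k. f (Matrix.mat n k x) * cnj (g (Matrix.mat n k x)))"

text \<open>A function of the first \<open>k\<close> columns regarded as a function of \<open>k + 1\<close> columns.\<close>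

definition fock_embed :: "nat \<Rightarrow> nat \<Rightarrow> (complex mat \<Rightarrow> complex) \<Rightarrow> complex mat \<Rightarrow> complex" where
  "fock_embed n k f Z =
     (if Z \<in> carrier_mat n (Suc k) then f (Matrix.mat n k (\<lambda>(i, j). Z $$ (i, j))) else 0)"

text \<open>The Hilbert space \<^typ>\<open>'f\<close> with the maps \<open>\<iota> k\<close> is the Hilbert-space completion of the
  inductive limit of the spaces \<^term>\<open>fock_space n k\<close>, \<open>k > 2 n\<close>. This determines \<^typ>\<open>'f\<close> and the
  maps up to a unique unitary map.\<close>

definition fock_completion ::
  "nat \<Rightarrow> (nat \<Rightarrow> (complex mat \<Rightarrow> complex) \<Rightarrow> 'f::chilbert_space) \<Rightarrow> bool" where
  "fock_completion n \<iota> \<longleftrightarrow>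
     (\<forall>k>2 * n. clinear_on (fock_space n k) (\<iota> k)) \<and>
     (\<forall>k>2 * n. \<forall>f\<in>fock_space n k. \<forall>g\<in>fock_space n k.
        cinner (\<iota> k f) (\<iota> k g) = fock_inner n k f g) \<and>
     (\<forall>k>2 * n. \<forall>f\<in>fock_space n k. \<iota> (Suc k) (fock_embed n k f) = \<iota> k f) \<and>
     closure (\<Union>k\<in>{2 * n<..}. \<iota> k ` fock_space n k) = UNIV"


section \<open>Topological groups and inductive limits of matrix groups\<close>

record 'g topgroup = "'g monoid" + gtop :: "'g topology"

definition topological_group :: "'g topgroup \<Rightarrow> bool" where
  "topological_group G \<longleftrightarrow> group G \<and> topspace (gtop G) = carrier G \<and>
     continuous_map (prod_topology (gtop G) (gtop G)) (gtop G) (\<lambda>(x, y). x \<otimes>\<^bsub>G\<^esub> y) \<and>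
     continuous_map (gtop G) (gtop G) (\<lambda>x. inv\<^bsub>G\<^esub> x)"

definition topological_subgroup :: "'g topgroup \<Rightarrow> 'g topgroup \<Rightarrow> bool" where
  "topological_subgroup K G \<longleftrightarrow> subgroup (carrier K) G \<and>
     K = G\<lparr>carrier := carrier K, gtop := subtopology (gtop G) (carrier K)\<rparr>"

definition prod_topgroup :: "'g topgroup \<Rightarrow> 'h topgroup \<Rightarrow> ('g \<times> 'h) topgroup" where
  "prod_topgroup G H =
     \<lparr>carrier = carrier (G \<times>\<times> H), mult = mult (G \<times>\<times> H), one = one (G \<times>\<times> H),
      gtop = prod_topology (gtop G) (gtop H)\<rparr>"

text \<open>A matrix \<open>g\<close> of size \<open>k\<close> is identified with the infinite matrix \<open>stab k g = diag(g, 1, 1, \<dots>)\<close>.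
  Under this identification the embedding of \<open>GL\<^sub>k\<close> into \<open>GL\<^sub>k\<^sub>+\<^sub>1\<close> is an inclusion (lemma
  \<open>stab_Suc\<close>), and the usual topology of \<open>GL\<^sub>k\<close> is induced by the product topology of the
  function type \<open>imat\<close>.\<close>

type_synonym imat = "nat \<times> nat \<Rightarrow> complex"

definition imat_one :: imat where
  "imat_one = (\<lambda>(i, j). if i = j then 1 else 0)"

definition imat_mult :: "imat \<Rightarrow> imat \<Rightarrow> imat" where
  "imat_mult A B = (\<lambda>(i, j). Sum_any (\<lambda>l. A (i, l) * B (l, j)))"

definition stab :: "nat \<Rightarrow> complex mat \<Rightarrow> imat" where
  "stab k g = (\<lambda>(i, j). if i < k \<and> j < k then g $$ (i, j) else imat_one (i, j))"

definition GL :: "nat \<Rightarrow> imat monoid" where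
  "GL k = \<lparr>carrier = stab k ` {g \<in> carrier_mat k k. invertible_mat g},
           mult = imat_mult, one = imat_one\<rparr>"

lemma stab_one: "stab k (1\<^sub>m k) = imat_one"
  by (auto simp: stab_def imat_one_def fun_eq_iff)

lemma stab_mult:
  assumes "a \<in> carrier_mat k k" "b \<in> carrier_mat k k"
  shows "imat_mult (stab k a) (stab k b) = stab k (a * b)"
proof (rule ext, clarify)
  fix i j
  let ?p = "\<lambda>l. stab k a (i, l) * stab k b (l, j)"
  show "imat_mult (stab k a) (stab k b) (i, j) = stab k (a * b) (i, j)"
  proof (cases "i < k")
    case True
    have "{l. ?p l \<noteq> 0} \<subseteq> {..<k}"
      using True by (auto simp: stab_def imat_one_def split: if_splits)
    then have "Sum_any ?p = sum ?p {..<k}"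
      by (rule Sum_any.expand_superset [OF finite_lessThan])
    also have "\<dots> = stab k (a * b) (i, j)"
    proof (cases "j < k")
      case True
      with \<open>i < k\<close> assms show ?thesis
        by (simp add: stab_def scalar_prod_def atLeast0LessThan)
    next
      case False
      with \<open>i < k\<close> show ?thesis
        by (auto simp: stab_def imat_one_def intro!: sum.neutral)
    qed
    finally show ?thesis by (simp only: imat_mult_def prod.case)
  next
    case False
    have "{l. ?p l \<noteq> 0} \<subseteq> {i}"
      using False by (auto simp: stab_def imat_one_def split: if_splits)
    then have "Sum_any ?p = sum ?p {i}"
      by (rule Sum_any.expand_superset [OF finite.insertI [OF finite.emptyI]])
    also have "\<dots> = stab k (a * b) (i, j)"
      using False by (simp add: stab_def imat_one_def)
    finally show ?thesis by (simp only: imat_mult_def prod.case)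
  qed
qed

lemma stab_Suc:
  assumes "g \<in> carrier_mat k k"
  shows "stab (Suc k) (four_block_mat g (0\<^sub>m k 1) (0\<^sub>m 1 k) (1\<^sub>m 1)) = stab k g"
  using assms by (auto simp: stab_def imat_one_def fun_eq_iff)

lemma inj_on_stab: "inj_on (stab k) (carrier_mat k k)"
proof (rule inj_onI, rule eq_matI)
  fix a b i j
  assume *: "a \<in> carrier_mat k k" "b \<in> carrier_mat k k" "stab k a = stab k b"
    "i < dim_row b" "j < dim_col b"
  have "stab k a (i, j) = stab k b (i, j)"
    using *(3) by simp
  then show "a $$ (i, j) = b $$ (i, j)"
    using *(2,4,5) by (simp add: stab_def)
qed auto

lemma invertible_mat_iff:
  assumes "a \<in> carrier_mat k k"
  shows "invertible_mat a \<longleftrightarrow> (\<exists>b\<in>carrier_mat k k. a * b = 1\<^sub>m k \<and> b * a = 1\<^sub>m k)"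
proof
  assume "invertible_mat a"
  then obtain b where b: "a * b = 1\<^sub>m k" "b * a = 1\<^sub>m (dim_row b)"
    using assms by (auto simp: invertible_mat_def inverts_mat_def)
  from arg_cong [OF b(1), of dim_col] arg_cong [OF b(2), of dim_col]
  have "b \<in> carrier_mat k k" using assms by auto
  with b show "\<exists>b\<in>carrier_mat k k. a * b = 1\<^sub>m k \<and> b * a = 1\<^sub>m k" by auto
next
  assume "\<exists>b\<in>carrier_mat k k. a * b = 1\<^sub>m k \<and> b * a = 1\<^sub>m k"
  with assms show "invertible_mat a"
    by (auto simp: invertible_mat_def inverts_mat_def)
qed

lemma group_GL: "group (GL k)"
proof (rule groupI)
  fix x y z
  assume "x \<in> carrier (GL k)" "y \<in> carrier (GL k)" "z \<in> carrier (GL k)"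
  then obtain a b c where
    a: "x = stab k a" "a \<in> carrier_mat k k" "invertible_mat a" and
    b: "y = stab k b" "b \<in> carrier_mat k k" "invertible_mat b" and
    c: "z = stab k c" "c \<in> carrier_mat k k" "invertible_mat c"
    by (auto simp: GL_def)
  show "x \<otimes>\<^bsub>GL k\<^esub> y \<otimes>\<^bsub>GL k\<^esub> z = x \<otimes>\<^bsub>GL k\<^esub> (y \<otimes>\<^bsub>GL k\<^esub> z)"
    using a b c by (simp add: GL_def stab_mult)
next
  fix x y
  assume "x \<in> carrier (GL k)" "y \<in> carrier (GL k)"
  then obtain a b where
    a: "x = stab k a" "a \<in> carrier_mat k k" "invertible_mat a" and
    b: "y = stab k b" "b \<in> carrier_mat k k" "invertible_mat b"
    by (auto simp: GL_def)
  obtain a' b' where a': "a * a' = 1\<^sub>m k" "a' * a = 1\<^sub>m k" "a' \<in> carrier_mat k k"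
    and b': "b * b' = 1\<^sub>m k" "b' * b = 1\<^sub>m k" "b' \<in> carrier_mat k k"
    using a b by (auto simp: invertible_mat_iff)
  have "(c * d) * (d' * c') = 1\<^sub>m k"
    if "c \<in> carrier_mat k k" "d \<in> carrier_mat k k" "c' \<in> carrier_mat k k" "d' \<in> carrier_mat k k"
      "c * c' = 1\<^sub>m k" "d * d' = 1\<^sub>m k" for c d c' d' :: "complex mat"
  proof -
    have "(c * d) * (d' * c') = c * ((d * d') * c')"
      using that(1-4) by (simp add: assoc_mult_mat [of _ k k _ k _ k])
    with that show ?thesis by simp
  qed
  note * = this [of a b a' b'] this [of b' a' b a]
  have "invertible_mat (a * b)"
    unfolding invertible_mat_iff [OF mult_carrier_mat [OF a(2) b(2)]]
    by (rule bexI [of _ "b' * a'"]) (use * a(2) b(2) a' b' in blast, use a' b' in simp)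
  then show "x \<otimes>\<^bsub>GL k\<^esub> y \<in> carrier (GL k)"
    using a b by (auto simp: GL_def stab_mult)
next
  have "invertible_mat (1\<^sub>m k :: complex mat)"
    by (auto simp: invertible_mat_iff [of _ k])
  then show "\<one>\<^bsub>GL k\<^esub> \<in> carrier (GL k)"
    by (auto simp: GL_def stab_one intro!: image_eqI [of _ _ "1\<^sub>m k"])
next
  fix x
  assume "x \<in> carrier (GL k)"
  then obtain a where a: "x = stab k a" "a \<in> carrier_mat k k" "invertible_mat a"
    by (auto simp: GL_def)
  show "\<one>\<^bsub>GL k\<^esub> \<otimes>\<^bsub>GL k\<^esub> x = x"
    using a stab_mult [OF one_carrier_mat a(2)] by (simp add: GL_def stab_one)
  obtain a' where a': "a * a' = 1\<^sub>m k" "a' * a = 1\<^sub>m k" "a' \<in> carrier_mat k k"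
    using a by (auto simp: invertible_mat_iff)
  then have "invertible_mat a'"
    using a by (auto simp: invertible_mat_iff [of _ k])
  then show "\<exists>y\<in>carrier (GL k). y \<otimes>\<^bsub>GL k\<^esub> x = \<one>\<^bsub>GL k\<^esub>"
    using a a' by (intro bexI [of _ "stab k a'"]) (auto simp: GL_def stab_mult stab_one)
qed

definition compact_group_chain :: "nat \<Rightarrow> (nat \<Rightarrow> imat set) \<Rightarrow> bool" where
  "compact_group_chain k\<^sub>0 G \<longleftrightarrow>
     (\<forall>k\<ge>k\<^sub>0. subgroup (G k) (GL k) \<and> compact (G k) \<and> G k \<subseteq> G (Suc k))"

definition inductive_limit :: "nat \<Rightarrow> (nat \<Rightarrow> imat set) \<Rightarrow> imat topgroup" where
  "inductive_limit k\<^sub>0 G =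
     \<lparr>carrier = (\<Union>k\<in>{k\<^sub>0..}. G k), mult = imat_mult, one = imat_one,
      gtop = topology (\<lambda>U. U \<subseteq> (\<Union>k\<in>{k\<^sub>0..}. G k) \<and>
                           (\<forall>k\<ge>k\<^sub>0. openin (top_of_set (G k)) (U \<inter> G k)))\<rparr>"

lemma openin_inductive_limit:
  "openin (gtop (inductive_limit k\<^sub>0 G)) U \<longleftrightarrow>
     U \<subseteq> (\<Union>k\<in>{k\<^sub>0..}. G k) \<and> (\<forall>k\<ge>k\<^sub>0. openin (top_of_set (G k)) (U \<inter> G k))"
proof -
  have "istopology (\<lambda>U. U \<subseteq> (\<Union>k\<in>{k\<^sub>0..}. G k) \<and> (\<forall>k\<ge>k\<^sub>0. openin (top_of_set (G k)) (U \<inter> G k)))"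
    unfolding istopology_def
  proof (intro conjI allI impI)
    fix S T k
    assume "S \<subseteq> (\<Union>k\<in>{k\<^sub>0..}. G k) \<and> (\<forall>k\<ge>k\<^sub>0. openin (top_of_set (G k)) (S \<inter> G k))"
      "T \<subseteq> (\<Union>k\<in>{k\<^sub>0..}. G k) \<and> (\<forall>k\<ge>k\<^sub>0. openin (top_of_set (G k)) (T \<inter> G k))" "k\<^sub>0 \<le> k"
    then have "openin (top_of_set (G k)) ((S \<inter> G k) \<inter> (T \<inter> G k))"
      by blast
    then show "openin (top_of_set (G k)) (S \<inter> T \<inter> G k)"
      by (simp add: Int_ac)
  next
    fix \<K> k
    assume *: "\<forall>K\<in>\<K>. K \<subseteq> (\<Union>k\<in>{k\<^sub>0..}. G k) \<and>
      (\<forall>k\<ge>k\<^sub>0. openin (top_of_set (G k)) (K \<inter> G k))" "k\<^sub>0 \<le> k"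
    have "openin (top_of_set (G k)) (\<Union>((\<lambda>K. K \<inter> G k) ` \<K>))"
      by (rule openin_Union) (use * in blast)
    moreover have "\<Union>((\<lambda>K. K \<inter> G k) ` \<K>) = \<Union>\<K> \<inter> G k"
      by blast
    ultimately show "openin (top_of_set (G k)) (\<Union>\<K> \<inter> G k)"
      by simp
  qed blast+
  then show ?thesis
    by (simp add: inductive_limit_def topology_inverse')
qed


section \<open>Unitary representations\<close>

text \<open>A representation is a closed subspace of a Hilbert space type together with an action on it.
  Only the values of the action at group elements and at vectors of the space matter, so the
  restriction of a representation to a subgroup is the same record read over the subgroup.\<close>

record ('g, 'v) rep =
  rep_space :: "'v set"
  rep_act :: "'g \<Rightarrow> 'v \<Rightarrow> 'v"

definition unitary_rep :: "'g topgroup \<Rightarrow> ('g, 'v::chilbert_space) rep \<Rightarrow> bool" where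
  "unitary_rep G \<rho> \<longleftrightarrow>
     closed_csubspace (rep_space \<rho>) \<and>
     (\<forall>g\<in>carrier G. unitary_map (rep_space \<rho>) (rep_space \<rho>) (rep_act \<rho> g)) \<and>
     (\<forall>v\<in>rep_space \<rho>. rep_act \<rho> \<one>\<^bsub>G\<^esub> v = v) \<and>
     (\<forall>g\<in>carrier G. \<forall>h\<in>carrier G. \<forall>v\<in>rep_space \<rho>.
        rep_act \<rho> (g \<otimes>\<^bsub>G\<^esub> h) v = rep_act \<rho> g (rep_act \<rho> h v)) \<and>
     (\<forall>v\<in>rep_space \<rho>. continuous_map (gtop G) euclidean (\<lambda>g. rep_act \<rho> g v))"

definition subrep :: "('g, 'v) rep \<Rightarrow> 'v set \<Rightarrow> ('g, 'v) rep" where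
  "subrep \<rho> S = \<rho>\<lparr>rep_space := S\<rparr>"

definition invariant_subspace :: "'g topgroup \<Rightarrow> ('g, 'v::chilbert_space) rep \<Rightarrow> 'v set \<Rightarrow> bool" where
  "invariant_subspace G \<rho> S \<longleftrightarrow> closed_csubspace S \<and> S \<subseteq> rep_space \<rho> \<and>
     (\<forall>g\<in>carrier G. rep_act \<rho> g ` S \<subseteq> S)"

definition irreducible_rep :: "'g topgroup \<Rightarrow> ('g, 'v::chilbert_space) rep \<Rightarrow> bool" where
  "irreducible_rep G \<rho> \<longleftrightarrow> unitary_rep G \<rho> \<and> rep_space \<rho> \<noteq> {0} \<and>
     (\<forall>S. invariant_subspace G \<rho> S \<longrightarrow> S = {0} \<or> S = rep_space \<rho>)"

definition is_restriction :: "'g topgroup \<Rightarrow> ('g, 'v) rep \<Rightarrow> ('g, 'v) rep \<Rightarrow> bool" where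
  "is_restriction K \<sigma> \<rho> \<longleftrightarrow> rep_space \<sigma> = rep_space \<rho> \<and>
     (\<forall>g\<in>carrier K. \<forall>v\<in>rep_space \<rho>. rep_act \<sigma> g v = rep_act \<rho> g v)"

definition rep_equiv ::
  "'g topgroup \<Rightarrow> ('g, 'v::chilbert_space) rep \<Rightarrow> ('g, 'w::chilbert_space) rep \<Rightarrow> bool" where
  "rep_equiv G \<rho> \<sigma> \<longleftrightarrow> (\<exists>U. unitary_map (rep_space \<rho>) (rep_space \<sigma>) U \<and>
     (\<forall>g\<in>carrier G. \<forall>v\<in>rep_space \<rho>. U (rep_act \<rho> g v) = rep_act \<sigma> g (U v)))"

text \<open>Intertwining maps are normalised to vanish off the space of \<open>\<rho>\<close>, so that distinct elements
  are distinct maps on that space; the vector space operations are pointwise.\<close>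

definition Hom_rep ::
  "'g topgroup \<Rightarrow> ('g, 'v::chilbert_space) rep \<Rightarrow> ('g, 'w::chilbert_space) rep \<Rightarrow> ('v \<Rightarrow> 'w) set" where
  "Hom_rep K \<rho> \<sigma> =
     {T. T ` rep_space \<rho> \<subseteq> rep_space \<sigma> \<and> clinear_on (rep_space \<rho>) T \<and>
         continuous_on (rep_space \<rho>) T \<and>
         (\<forall>g\<in>carrier K. \<forall>v\<in>rep_space \<rho>. T (rep_act \<rho> g v) = rep_act \<sigma> g (T v)) \<and>
         (\<forall>v. v \<notin> rep_space \<rho> \<longrightarrow> T v = 0)}"

definition completely_reducible :: "'g topgroup \<Rightarrow> ('g, 'v::chilbert_space) rep \<Rightarrow> bool" where
  "completely_reducible G \<rho> \<longleftrightarrow>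
     (\<exists>\<S>. (\<forall>S\<in>\<S>. irreducible_rep G (subrep \<rho> S)) \<and> hilbert_direct_sum (rep_space \<rho>) \<S> (\<lambda>S. S))"

definition isotypic_component ::
  "'g topgroup \<Rightarrow> ('g, 'v::chilbert_space) rep \<Rightarrow> ('g, 'w::chilbert_space) rep \<Rightarrow> 'v set" where
  "isotypic_component G R \<sigma> = closure (cspan (\<Union>{S. S \<subseteq> rep_space R \<and>
     irreducible_rep G (subrep R S) \<and> rep_equiv G (subrep R S) \<sigma>}))"


section \<open>Dual representations\<close>

definition joint_rep :: "('h, 'v) rep \<Rightarrow> ('g, 'v) rep \<Rightarrow> ('h \<times> 'g, 'v) rep" where
  "joint_rep R' R =
     \<lparr>rep_space = rep_space R, rep_act = (\<lambda>(g', g). rep_act R' g' \<circ> rep_act R g)\<rparr>"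

definition multiplicity_free_decomposition ::
  "'h topgroup \<Rightarrow> 'g topgroup \<Rightarrow> ('h, 'f::chilbert_space) rep \<Rightarrow> ('g, 'f) rep
     \<Rightarrow> 'f set \<Rightarrow> 'l set \<Rightarrow> ('l \<Rightarrow> 'f set) \<Rightarrow> bool" where
  "multiplicity_free_decomposition G' G R' R F \<Lambda> I \<longleftrightarrow>
     hilbert_direct_sum F \<Lambda> I \<and>
     (\<forall>l\<in>\<Lambda>. irreducible_rep (prod_topgroup G' G) (subrep (joint_rep R' R) (I l))) \<and>
     (\<forall>l\<in>\<Lambda>. \<forall>m\<in>\<Lambda>. l \<noteq> m \<longrightarrow>
        \<not> rep_equiv (prod_topgroup G' G) (subrep (joint_rep R' R) (I l)) (subrep (joint_rep R' R) (I m)))"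

text \<open>\<open>\<Lambda>\<close> is the set of common irreducible signatures of the pair \<open>(G', G)\<close>; a signature \<open>l\<close> stands
  for the class of the representation \<open>V l\<close> of \<open>G\<close> and for the class of the representation \<open>W l\<close>
  of \<open>G'\<close>.\<close>

definition dual_representations ::
  "'g topgroup \<Rightarrow> 'h topgroup \<Rightarrow> ('g, 'f::chilbert_space) rep \<Rightarrow> ('h, 'f) rep
     \<Rightarrow> 'l set \<Rightarrow> ('l \<Rightarrow> ('g, 'v::chilbert_space) rep) \<Rightarrow> ('l \<Rightarrow> ('h, 'w::chilbert_space) rep)
     \<Rightarrow> bool" where
  "dual_representations G G' R R' \<Lambda> V W \<longleftrightarrow>
     rep_space R = rep_space R' \<and>
     unitary_rep G R \<and> completely_reducible G R \<and>
     unitary_rep G' R' \<and> completely_reducible G' R' \<and>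
     (\<forall>g\<in>carrier G. \<forall>g'\<in>carrier G'. \<forall>x\<in>rep_space R.
        rep_act R g (rep_act R' g' x) = rep_act R' g' (rep_act R g x)) \<and>
     (\<forall>l\<in>\<Lambda>. irreducible_rep G (V l) \<and> irreducible_rep G' (W l)) \<and>
     (\<forall>l\<in>\<Lambda>. isotypic_component G R (V l) = isotypic_component G' R' (W l)) \<and>
     multiplicity_free_decomposition G' G R' R (rep_space R) \<Lambda> (\<lambda>l. isotypic_component G R (V l)) \<and>
     (\<forall>l\<in>\<Lambda>. \<exists>\<tau>.
        hilbert_tensor_product (rep_space (V l)) (rep_space (W l)) (isotypic_component G R (V l)) \<tau> \<and>
        (\<forall>g\<in>carrier G. \<forall>g'\<in>carrier G'. \<forall>v\<in>rep_space (V l). \<forall>w\<in>rep_space (W l).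
           rep_act R' g' (rep_act R g (\<tau> v w)) = \<tau> (rep_act (V l) g v) (rep_act (W l) g' w)))"

end

theory Submission
  imports Defs
begin

text \<open>Write the two decompositions of the Fock space as sums of \<open>V\<^sub>\<lambda> \<otimes> W\<^sub>\<lambda>\<close> (for \<open>G\<^sub>\<infinity>\<close> and \<open>G'\<close>) and of
  \<open>X\<^sub>\<mu> \<otimes> Y\<^sub>\<mu>\<close> (for \<open>H\<^sub>\<infinity>\<close> and \<open>H'\<close>), and fix isometric embeddings \<open>\<tau>\<close> and \<open>\<sigma>\<close> of these tensor
  products. The reciprocity of multiplicities comes from one explicit correspondence
  \<open>T \<leftrightarrow> S\<close> between intertwining maps \<open>T : X\<^sub>\<mu> \<rightarrow> V\<^sub>\<lambda>\<close> for \<open>H\<^sub>\<infinity>\<close> and \<open>S : W\<^sub>\<lambda> \<rightarrow> Y\<^sub>\<mu>\<close> for \<open>G'\<close>, namely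
  \<open>\<tau> (T x) w = \<sigma> x (S w)\<close>. Given \<open>T\<close> and a vector \<open>w\<close>, the map \<open>x \<mapsto> \<tau> (T x) w\<close> intertwines the actions of
  \<open>H\<^sub>\<infinity>\<close> on \<open>X\<^sub>\<mu>\<close> and on the Fock space. Its values therefore lie in the isotypic component of
  \<open>X\<^sub>\<mu>\<close> (lemma \<open>Hom_rep_image_subset_isotypic\<close>), which by duality is \<open>X\<^sub>\<mu> \<otimes> Y\<^sub>\<mu>\<close>, and an intertwining map
  from \<open>X\<^sub>\<mu>\<close> into \<open>X\<^sub>\<mu> \<otimes> Y\<^sub>\<mu>\<close> is \<open>x \<mapsto> \<sigma> x y\<close> for a single \<open>y\<close> (lemma \<open>Hom_rep_into_tensor\<close>); this \<open>y\<close> is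
  \<open>S w\<close>. The construction is symmetric under the exchange of \<open>H\<^sub>\<infinity>\<close> and \<open>G'\<close>, so lemma
  \<open>Hom_rep_transfer\<close> gives both directions. The correspondence is linear, hence the two spaces have equipotent bases, whatever
  their dimension.

  The analytic input is Schur's lemma for irreducible unitary representations on Hilbert spaces of
  arbitrary dimension. In the form needed it says that an invariant bounded sesquilinear form is a multiple
  of the inner product (lemma \<open>schur_form\<close>). Its proof replaces the spectral theorem by
  the absolute value \<open>\<bar>B\<bar>\<close> of a symmetric operator \<open>B\<close>, which commutes with everything that commutes with \<open>B\<close>:
  the kernel of \<open>\<bar>B\<bar> - B\<close> is an invariant subspace, so irreducibility forces \<open>B \<ge> 0\<close> or \<open>B \<le> 0\<close>.
  When this holds for \<open>B = A - c\<close> with every real \<open>c\<close>, the operator \<open>A\<close> is a scalar.\<close>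

text \<open>Bounded operators form a Banach space only over spaces of class \<^class>\<open>banach\<close>.\<close>

instance chilbert_space \<subseteq> banach ..

section \<open>Symmetric operators on real Hilbert spaces\<close>

text \<open>The representing vector is the minimiser of \<open>\<parallel>x\<parallel>\<^sup>2 - 2 \<phi> x\<close> over \<open>S\<close>. By the parallelogram law every
  minimising sequence is Cauchy, and the derivative of this functional vanishes at its minimum.\<close>

lemma real_riesz:
  fixes S :: "'a::{real_inner,banach} set" and \<phi> :: "'a \<Rightarrow> real"
  assumes sub: "real_vector.subspace S" and cl: "closed S"
    and add: "\<And>x y. x \<in> S \<Longrightarrow> y \<in> S \<Longrightarrow> \<phi> (x + y) = \<phi> x + \<phi> y"
    and scale: "\<And>r x. x \<in> S \<Longrightarrow> \<phi> (r *\<^sub>R x) = r * \<phi> x"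
    and bound: "\<And>x. x \<in> S \<Longrightarrow> \<bar>\<phi> x\<bar> \<le> K * norm x"
  shows "\<exists>y\<in>S. \<forall>x\<in>S. \<phi> x = inner x y"
proof -
  define J where "J x = (norm x)\<^sup>2 - 2 * \<phi> x" for x
  define m where "m = Inf (J ` S)"
  have 0: "0 \<in> S" using sub by (rule real_vector.subspace_0)
  have lower: "- K\<^sup>2 \<le> J x" if "x \<in> S" for x
  proof -
    have "0 \<le> (norm x - K)\<^sup>2" by simp
    then have "2 * (K * norm x) \<le> (norm x)\<^sup>2 + K\<^sup>2"
      by (simp add: power2_diff algebra_simps)
    with bound[OF that] show ?thesis unfolding J_def by linarith
  qed
  then have bdd: "bdd_below (J ` S)" by (auto intro!: bdd_belowI)
  have m_le: "m \<le> J x" if "x \<in> S" for x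
    unfolding m_def using bdd that by (simp add: cINF_lower)
  have mid: "(norm (x - y))\<^sup>2 \<le> 2 * (J x + J y - 2 * m)" if "x \<in> S" "y \<in> S" for x y
  proof -
    let ?z = "(1/2) *\<^sub>R (x + y)"
    have z: "?z \<in> S" using sub that by (simp add: real_vector.subspace_add real_vector.subspace_scale)
    have "\<phi> ?z = (\<phi> x + \<phi> y) / 2"
      using add[OF that] scale[of "x + y" "1/2"] sub that by (simp add: real_vector.subspace_add)
    moreover have "(norm ?z)\<^sup>2 = (norm (x + y))\<^sup>2 / 4"
      by (simp add: power_divide)
    moreover have "(norm (x - y))\<^sup>2 + (norm (x + y))\<^sup>2 = 2 * (norm x)\<^sup>2 + 2 * (norm y)\<^sup>2"
      unfolding power2_norm_eq_inner by (simp add: algebra_simps inner_commute)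
    ultimately have "(norm (x - y))\<^sup>2 = 2 * (J x + J y - 2 * J ?z)"
      unfolding J_def by (simp add: field_simps)
    with m_le[OF z] show ?thesis by simp
  qed
  define r where "r n = 1 / real (Suc n)" for n
  have "\<exists>x\<in>S. J x < m + r n" for n
    using cINF_less_iff[of S J "m + r n"] 0 bdd unfolding m_def r_def by auto
  then obtain X where X: "\<And>n. X n \<in> S" "\<And>n. J (X n) < m + r n" by metis
  have "Cauchy X"
  proof (rule metric_CauchyI)
    fix e :: real assume e: "0 < e"
    obtain N where N: "r N < e\<^sup>2 / 4"
      unfolding r_def using e nat_approx_posE[of "e\<^sup>2 / 4"] by (metis divide_pos_pos zero_less_numeral zero_less_power)
    have "dist (X i) (X j) < e" if "i \<ge> N" "j \<ge> N" for i j
    proof -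
      have "r i \<le> r N" "r j \<le> r N"
        using that unfolding r_def by (simp_all add: frac_le)
      have gap: "q < E" if "q \<le> 2 * (a + b - 2 * m)" "a < m + u" "b < m + v" "w < E / 4" "u \<le> w" "v \<le> w"
        for q E a b u v w :: real
        using that by argo
      from gap[OF mid[OF X(1) X(1)] X(2) X(2) N \<open>r i \<le> r N\<close> \<open>r j \<le> r N\<close>]
      have "(norm (X i - X j))\<^sup>2 < e\<^sup>2" .
      then show ?thesis using e power_less_imp_less_base[of "norm (X i - X j)" 2 e]
        by (simp add: dist_norm)
    qed
    then show "\<exists>N. \<forall>i\<ge>N. \<forall>j\<ge>N. dist (X i) (X j) < e" by blast
  qed
  then obtain y where y: "X \<longlonglongrightarrow> y" using Cauchy_convergent convergent_def by blast
  have yS: "y \<in> S" using closed_sequentially[OF cl _ y] X(1) by blast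
  have sub_phi: "\<phi> (a - b) = \<phi> a - \<phi> b" if "a \<in> S" "b \<in> S" for a b
    using add[of a "- b"] scale[of b "-1"] that sub by (simp add: real_vector.subspace_neg)
  have "(\<lambda>n. \<phi> (X n)) \<longlonglongrightarrow> \<phi> y"
  proof (rule Lim_null_comparison[THEN LIM_zero_cancel])
    show "\<forall>\<^sub>F n in sequentially. norm (\<phi> (X n) - \<phi> y) \<le> K * norm (X n - y)"
      using bound[OF real_vector.subspace_diff[OF sub X(1) yS]] sub_phi[OF X(1) yS] by simp
    show "(\<lambda>n. K * norm (X n - y)) \<longlonglongrightarrow> 0"
      using y by (auto intro!: tendsto_eq_intros simp: LIM_zero_iff)
  qed
  then have "(\<lambda>n. J (X n)) \<longlonglongrightarrow> J y"
    unfolding J_def using y by (intro tendsto_intros)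
  moreover have "(\<lambda>n. m + r n) \<longlonglongrightarrow> m + 0"
    unfolding r_def by (intro tendsto_intros LIMSEQ_Suc[OF lim_1_over_n])
  ultimately have "J y \<le> m + 0"
    using X(2) by (intro LIMSEQ_le) (auto intro: less_imp_le)
  have "\<phi> x = inner x y" if x: "x \<in> S" for x
  proof -
    define d where "d = inner y x - \<phi> x"
    \<comment> \<open>The step \<open>t\<close> would decrease \<open>J\<close> if \<open>d\<close> were not \<open>0\<close>; adding \<open>1\<close> to \<open>\<parallel>x\<parallel>\<^sup>2\<close> avoids the case \<open>x = 0\<close>.\<close>
    define q where "q = (norm x)\<^sup>2 + 1"
    define t where "t = - d / q"
    have q: "q > 0" unfolding q_def by (simp add: add_nonneg_pos)
    have tq: "t * q = - d" using q by (simp add: t_def)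
    have tx: "t *\<^sub>R x \<in> S" using sub x by (simp add: real_vector.subspace_scale)
    have "J y \<le> J (y + t *\<^sub>R x)"
      using \<open>J y \<le> m + 0\<close> m_le[OF real_vector.subspace_add[OF sub yS tx]] by simp
    also have "\<dots> = J y + t\<^sup>2 * (norm x)\<^sup>2 + 2 * t * d"
      unfolding J_def add[OF yS tx] scale[OF x] d_def power2_norm_eq_inner
      by (simp add: algebra_simps inner_commute power2_eq_square)
    finally have "0 \<le> t\<^sup>2 * (norm x)\<^sup>2 + 2 * t * d" by simp
    then have "0 \<le> q\<^sup>2 * (t\<^sup>2 * (norm x)\<^sup>2 + 2 * t * d)"
      by simp
    also have "\<dots> = (t * q)\<^sup>2 * (norm x)\<^sup>2 + 2 * (t * q) * d * q"
      by (simp add: power2_eq_square algebra_simps)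
    also have "\<dots> = - (d\<^sup>2 * (q + 1))"
      unfolding tq by (simp add: q_def power2_eq_square algebra_simps)
    finally have "d\<^sup>2 * (q + 1) \<le> 0" by simp
    then have "d = 0" using q by (auto simp: mult_le_0_iff)
    then show ?thesis by (simp add: d_def inner_commute)
  qed
  with yS show ?thesis by blast
qed

lemma orthogonal_projection:
  fixes S :: "'a::{real_inner,banach} set"
  assumes sub: "real_vector.subspace S" and cl: "closed S"
  obtains P where "bounded_linear P" "\<And>x. P x \<in> S" "\<And>x. x \<in> S \<Longrightarrow> P x = x"
    "\<And>x y. y \<in> S \<Longrightarrow> inner (P x) y = inner x y"
proof -
  have "\<exists>p\<in>S. \<forall>y\<in>S. inner y x = inner y p" for x
    by (rule real_riesz[OF sub cl, of "\<lambda>y. inner y x" "norm x"])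
      (auto simp: inner_add_left mult.commute[of "norm x"] Cauchy_Schwarz_ineq2)
  then obtain P where P: "\<And>x. P x \<in> S" "\<And>x y. y \<in> S \<Longrightarrow> inner y x = inner y (P x)"
    by metis
  have uniq: "p = P x" if "p \<in> S" "\<And>y. y \<in> S \<Longrightarrow> inner y x = inner y p" for p x
  proof -
    have "inner (p - P x) (p - P x) = 0"
      using P(2)[of "p - P x" x] that(2)[of "p - P x"] real_vector.subspace_diff[OF sub that(1) P(1)]
      by (simp add: inner_diff_right)
    then show ?thesis by simp
  qed
  have "norm (P x) \<le> norm x * 1" for x
  proof -
    have "norm (P x) * norm (P x) \<le> norm (P x) * norm x"
      using P(2)[OF P(1), of x x] norm_cauchy_schwarz[of "P x" x]
      by (simp add: power2_norm_eq_inner[symmetric] power2_eq_square)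
    then show ?thesis by (cases "P x = 0") auto
  qed
  then have "bounded_linear P"
    by (intro bounded_linear_intro[where K = 1])
      (auto intro!: uniq[symmetric] real_vector.subspace_add[OF sub] real_vector.subspace_scale[OF sub] P
        simp: inner_add_right P(2)[symmetric])
  moreover have "P x = x" if "x \<in> S" for x
    using uniq[OF that] by simp
  ultimately show ?thesis
    using that P by (metis inner_commute)
qed

text \<open>The square root of \<open>1 - C\<close> for a contraction \<open>C\<close> is \<open>1 - Y\<close> where \<open>Y = (C + Y\<^sup>2) / 2\<close>. The
  iteration for this fixed point is dominated in norm, term by term, by the same iteration for the
  number \<open>1\<close>, which increases and stays below \<open>1\<close>; hence it converges in operator
  norm. The iterates are polynomials in \<open>C\<close>, so the limit commutes with whatever commutes with \<open>C\<close>.\<close>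

lemma contraction_fixed_point:
  fixes C :: "'a::banach \<Rightarrow>\<^sub>L 'a"
  assumes C: "norm C \<le> 1"
  obtains Y where "norm Y \<le> 1" "2 *\<^sub>R Y = C + (Y o\<^sub>L Y)"
    "\<And>U. U o\<^sub>L C = C o\<^sub>L U \<Longrightarrow> U o\<^sub>L Y = Y o\<^sub>L U"
proof -
  define Z where "Z = rec_nat 0 (\<lambda>_ Y. (1/2) *\<^sub>R (C + (Y o\<^sub>L Y)))"
  define z where "z = rec_nat (0::real) (\<lambda>_ y. (1 + y\<^sup>2) / 2)"
  have Z_Suc: "Z (Suc n) = (1/2) *\<^sub>R (C + (Z n o\<^sub>L Z n))" and z_Suc: "z (Suc n) = (1 + (z n)\<^sup>2) / 2" for n
    by (simp_all add: Z_def z_def)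
  have Z_0 [simp]: "Z 0 = 0" and z_0 [simp]: "z 0 = 0" by (simp_all add: Z_def z_def)
  have z_bounds: "0 \<le> z n \<and> z n \<le> 1" for n
    by (induction n) (auto simp: z_Suc power_le_one)
  have Z_le: "norm (Z n) \<le> z n" for n
  proof (induction n)
    case (Suc n)
    have "norm (C + (Z n o\<^sub>L Z n)) \<le> 1 + (z n)\<^sup>2"
      using norm_triangle_ineq[of C "Z n o\<^sub>L Z n"] C norm_blinfun_compose[of "Z n" "Z n"]
        mult_mono[OF Suc Suc _ norm_ge_zero] z_bounds[of n] unfolding power2_eq_square by linarith
    then show ?case by (simp add: Z_Suc z_Suc)
  qed simp
  have telescope: "(1/2) *\<^sub>R (C + (A o\<^sub>L A)) - (1/2) *\<^sub>R (C + (B o\<^sub>L B)) =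
      (1/2) *\<^sub>R ((A o\<^sub>L (A - B)) + ((A - B) o\<^sub>L B))" for A B
    by (rule blinfun_eqI) (simp add: blinfun.bilinear_simps algebra_simps)
  have Z_diff: "norm (Z (Suc n) - Z n) \<le> z (Suc n) - z n" for n
  proof (induction n)
    case 0
    then show ?case using C by (simp add: Z_Suc z_Suc)
  next
    case (Suc n)
    let ?D = "Z (Suc n) - Z n" and ?d = "z (Suc n) - z n"
    have "Z (Suc (Suc n)) - Z (Suc n) = (1/2) *\<^sub>R ((Z (Suc n) o\<^sub>L ?D) + (?D o\<^sub>L Z n))"
      using telescope[of "Z (Suc n)" "Z n"] by (simp only: Z_Suc[symmetric])
    then have "norm (Z (Suc (Suc n)) - Z (Suc n)) \<le>
        (norm (Z (Suc n) o\<^sub>L ?D) + norm (?D o\<^sub>L Z n)) / 2"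
      using norm_triangle_ineq[of "Z (Suc n) o\<^sub>L ?D" "?D o\<^sub>L Z n"] by simp
    also have "\<dots> \<le> (z (Suc n) * ?d + ?d * z n) / 2"
      using norm_blinfun_compose[of "Z (Suc n)" ?D] norm_blinfun_compose[of ?D "Z n"]
        mult_mono[OF Z_le[of "Suc n"] Suc] mult_mono[OF Suc Z_le[of n]]
        z_bounds[of n] z_bounds[of "Suc n"] order_trans[OF norm_ge_zero Suc] by simp
    also have "\<dots> = z (Suc (Suc n)) - z (Suc n)"
      unfolding z_Suc[of "Suc n"] by (simp add: z_Suc power2_eq_square field_simps)
    finally show ?case .
  qed
  have "incseq z" using Z_diff order_trans[OF norm_ge_zero] by (intro incseq_SucI) fastforce
  then obtain l where "z \<longlonglongrightarrow> l" using incseq_convergent[of z 1] z_bounds by blast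
  then have "summable (\<lambda>n. z (Suc n) - z n)" using telescope_summable by blast
  then have "summable (\<lambda>n. Z (Suc n) - Z n)"
    by (rule summable_comparison_test'[where N = 0]) (use Z_diff in auto)
  then have "convergent (\<lambda>n. \<Sum>i<n. Z (Suc i) - Z i)" by (simp add: summable_iff_convergent)
  moreover have "(\<Sum>i<n. Z (Suc i) - Z i) = Z n" for n by (simp add: sum_lessThan_telescope)
  ultimately obtain Y where Y: "Z \<longlonglongrightarrow> Y" by (auto simp: convergent_def)
  have "norm (Z n) \<le> 1" for n using Z_le[of n] z_bounds[of n] by linarith
  then have "norm Y \<le> 1" by (intro LIMSEQ_le_const2[OF tendsto_norm[OF Y]]) auto
  moreover have "2 *\<^sub>R Y = C + (Y o\<^sub>L Y)"
  proof (rule LIMSEQ_unique)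
    show "(\<lambda>n. 2 *\<^sub>R Z (Suc n)) \<longlonglongrightarrow> 2 *\<^sub>R Y"
      by (intro tendsto_intros LIMSEQ_Suc[OF Y])
    show "(\<lambda>n. 2 *\<^sub>R Z (Suc n)) \<longlonglongrightarrow> C + (Y o\<^sub>L Y)"
      unfolding Z_Suc using Y
      by (auto intro!: tendsto_intros bounded_bilinear.tendsto[OF bounded_bilinear_blinfun_compose])
  qed
  moreover have "U o\<^sub>L Y = Y o\<^sub>L U" if U: "U o\<^sub>L C = C o\<^sub>L U" for U
  proof -
    have "U o\<^sub>L Z n = Z n o\<^sub>L U" for n
    proof (induction n)
      case (Suc n)
      have UC: "U (C x) = C (U x)" and UZ: "U (Z n x) = Z n (U x)" for x
        using arg_cong[OF U, of "\<lambda>f. blinfun_apply f x"] arg_cong[OF Suc, of "\<lambda>f. blinfun_apply f x"] by simp_all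
      show ?case unfolding Z_Suc by (rule blinfun_eqI) (simp add: blinfun.bilinear_simps UC UZ)
    qed (simp add: blinfun_eqI)
    then have "(\<lambda>n. U o\<^sub>L Z n) \<longlonglongrightarrow> (Y o\<^sub>L U)"
      using Y by (auto intro!: bounded_bilinear.tendsto[OF bounded_bilinear_blinfun_compose])
    moreover have "(\<lambda>n. U o\<^sub>L Z n) \<longlonglongrightarrow> (U o\<^sub>L Y)"
      using Y by (auto intro!: bounded_bilinear.tendsto[OF bounded_bilinear_blinfun_compose])
    ultimately show ?thesis using LIMSEQ_unique by blast
  qed
  ultimately show ?thesis using that by blast
qed

text \<open>The absolute value of \<open>B\<close> is the square root of \<open>B\<^sup>2\<close>. With \<open>k\<close> a bound for \<open>B\<close>, the operator
  \<open>C = 1 - B\<^sup>2 / k\<^sup>2\<close> is a contraction because \<open>B\<close> is symmetric, and \<open>k (1 - Y)\<close> is the required root for the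
  fixed point \<open>Y\<close> belonging to \<open>C\<close>. The bound \<open>\<parallel>Y\<parallel> \<le> 1\<close> makes the root positive.\<close>

lemma absolute_value_operator:
  fixes B :: "'a::{real_inner,banach} \<Rightarrow> 'a"
  assumes B: "bounded_linear B" and sym: "\<And>x y. inner (B x) y = inner x (B y)"
  obtains D where "bounded_linear D" "\<And>x. D (D x) = B (B x)" "\<And>x. 0 \<le> inner (D x) x"
    "\<And>U x. bounded_linear U \<Longrightarrow> (\<And>y. U (B y) = B (U y)) \<Longrightarrow> U (D x) = D (U x)"
proof -
  interpret B: bounded_linear B by fact
  obtain k where k: "0 < k" "\<And>x. norm (B x) \<le> norm x * k" using B.pos_bounded by blast
  define b where "b = Blinfun B"
  have b [simp]: "blinfun_apply b = B" unfolding b_def using B by (rule bounded_linear_Blinfun_apply)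
  define c where "c = 1 / k\<^sup>2"
  have c: "0 \<le> c" by (simp add: c_def)
  define C where "C = id_blinfun - c *\<^sub>R (b o\<^sub>L b)"
  have C: "C x = x - c *\<^sub>R B (B x)" for x
    by (simp add: C_def blinfun.bilinear_simps)
  have "norm (C x) \<le> 1 * norm x" for x
  proof -
    have "(norm (B (B x)))\<^sup>2 \<le> (norm (B x) * k)\<^sup>2"
      using k(2)[of "B x"] by (intro power_mono) auto
    then have *: "c\<^sup>2 * (norm (B (B x)))\<^sup>2 \<le> c * (norm (B x))\<^sup>2"
      using k(1) unfolding c_def by (simp add: field_simps power2_eq_square)
    have expand: "(norm (x - c *\<^sub>R z))\<^sup>2 = (norm x)\<^sup>2 - 2 * c * inner x z + c\<^sup>2 * (norm z)\<^sup>2"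
      for z
      unfolding power2_norm_eq_inner
      by (simp add: inner_diff_left inner_diff_right inner_commute[of z x] power2_eq_square algebra_simps)
    have "inner x (B (B x)) = (norm (B x))\<^sup>2"
      using sym[of x "B x"] by (simp add: power2_norm_eq_inner)
    then have "(norm (C x))\<^sup>2 = (norm x)\<^sup>2 - 2 * c * (norm (B x))\<^sup>2 + c\<^sup>2 * (norm (B (B x)))\<^sup>2"
      unfolding C expand by simp
    also have "\<dots> \<le> (norm x)\<^sup>2 - c * (norm (B x))\<^sup>2"
      using * by linarith
    also have "\<dots> \<le> (norm x)\<^sup>2" using c by simp
    finally show ?thesis using power2_le_imp_le[OF _ norm_ge_zero] by simp
  qed
  then have "norm C \<le> 1" by (intro norm_blinfun_bound) auto
  then obtain Y where Y: "norm Y \<le> 1" "2 *\<^sub>R Y = C + (Y o\<^sub>L Y)"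
    "\<And>U. U o\<^sub>L C = C o\<^sub>L U \<Longrightarrow> U o\<^sub>L Y = Y o\<^sub>L U"
    by (rule contraction_fixed_point) blast
  define D where "D x = k *\<^sub>R (x - Y x)" for x
  have bl: "bounded_linear D" unfolding D_def by (intro bounded_linear_intros)
  have "D (D x) = B (B x)" for x
  proof -
    have "2 *\<^sub>R Y x = C x + Y (Y x)"
      using arg_cong[OF Y(2), of "\<lambda>f. blinfun_apply f x"] by (simp add: blinfun.bilinear_simps)
    then have "x - 2 *\<^sub>R Y x + Y (Y x) = c *\<^sub>R B (B x)"
      by (simp add: C algebra_simps)
    moreover have "D (D x) = k\<^sup>2 *\<^sub>R (x - 2 *\<^sub>R Y x + Y (Y x))"
      unfolding D_def by (simp add: blinfun.bilinear_simps algebra_simps power2_eq_square scaleR_2)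
    ultimately show ?thesis using k(1) by (simp add: c_def)
  qed
  moreover have "0 \<le> inner (D x) x" for x
  proof -
    have "norm (Y x) \<le> norm x" using norm_blinfun[of Y x] Y(1) mult_right_mono[OF Y(1), of "norm x"] by simp
    then have "inner (Y x) x \<le> norm x * norm x"
      using norm_cauchy_schwarz[of "Y x" x] mult_right_mono[of "norm (Y x)" "norm x" "norm x"] by simp
    also have "\<dots> = inner x x" by (simp add: power2_norm_eq_inner[symmetric] power2_eq_square)
    finally show ?thesis using k(1) unfolding D_def by (simp add: inner_diff_left)
  qed
  moreover have "U (D x) = D (U x)" if U: "bounded_linear U" "\<And>y. U (B y) = B (U y)" for U x
  proof -
    interpret U: bounded_linear U by fact
    define u where "u = Blinfun U"
    have u [simp]: "blinfun_apply u = U" unfolding u_def using U(1) by (rule bounded_linear_Blinfun_apply)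
    have "u o\<^sub>L C = C o\<^sub>L u"
      by (rule blinfun_eqI) (simp add: C U.diff U.scaleR U(2))
    from arg_cong[OF Y(3)[OF this], of "\<lambda>f. blinfun_apply f x"]
    have "U (Y x) = Y (U x)" by simp
    then show ?thesis unfolding D_def by (simp add: U.diff U.scaleR)
  qed
  ultimately show ?thesis using that bl by blast
qed

text \<open>Schur's lemma for a family \<open>\<U>\<close> of orthogonal maps acting irreducibly on \<open>S\<close>. The form is
  represented by a symmetric operator \<open>A\<close>, extended to the whole space by means of the orthogonal
  projection onto \<open>S\<close>, and \<open>A\<close> commutes with \<open>\<U>\<close>. For each real \<open>c\<close> the sign of \<open>A - c\<close> is constant on
  \<open>S\<close> (the fact \<open>dichotomy\<close>), so all Rayleigh quotients of \<open>A\<close> coincide.\<close>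

lemma real_schur:
  fixes S :: "'a::{real_inner,banach} set" and \<beta> :: "'a \<Rightarrow> 'a \<Rightarrow> real"
  assumes sub: "real_vector.subspace S" and cl: "closed S"
    and add: "\<And>x y z. x \<in> S \<Longrightarrow> y \<in> S \<Longrightarrow> z \<in> S \<Longrightarrow> \<beta> (x + y) z = \<beta> x z + \<beta> y z"
    and scale: "\<And>r x y. x \<in> S \<Longrightarrow> y \<in> S \<Longrightarrow> \<beta> (r *\<^sub>R x) y = r * \<beta> x y"
    and sym: "\<And>x y. x \<in> S \<Longrightarrow> y \<in> S \<Longrightarrow> \<beta> x y = \<beta> y x"
    and bound: "\<And>x y. x \<in> S \<Longrightarrow> y \<in> S \<Longrightarrow> \<bar>\<beta> x y\<bar> \<le> K * norm x * norm y"
    and U_onto: "\<And>u. u \<in> \<U> \<Longrightarrow> u ` S = S"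
    and U_add: "\<And>u x y. u \<in> \<U> \<Longrightarrow> x \<in> S \<Longrightarrow> y \<in> S \<Longrightarrow> u (x + y) = u x + u y"
    and U_scale: "\<And>u r x. u \<in> \<U> \<Longrightarrow> x \<in> S \<Longrightarrow> u (r *\<^sub>R x) = r *\<^sub>R u x"
    and U_inner: "\<And>u x y. u \<in> \<U> \<Longrightarrow> x \<in> S \<Longrightarrow> y \<in> S \<Longrightarrow> inner (u x) (u y) = inner x y"
    and inv: "\<And>u x y. u \<in> \<U> \<Longrightarrow> x \<in> S \<Longrightarrow> y \<in> S \<Longrightarrow> \<beta> (u x) (u y) = \<beta> x y"
    and irreducible: "\<And>T. real_vector.subspace T \<Longrightarrow> closed T \<Longrightarrow> T \<subseteq> S \<Longrightarrow>
      (\<And>u. u \<in> \<U> \<Longrightarrow> u ` T \<subseteq> T) \<Longrightarrow> T = {0} \<or> T = S"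
  shows "\<exists>c. \<forall>x\<in>S. \<forall>y\<in>S. \<beta> x y = c * inner x y"
proof -
  note sub_add = real_vector.subspace_add[OF sub] and sub_scale = real_vector.subspace_scale[OF sub]
    and sub_diff = real_vector.subspace_diff[OF sub]
  have eq_in_S: "a = b" if "a \<in> S" "b \<in> S" "\<And>y. y \<in> S \<Longrightarrow> inner y a = inner y b" for a b
  proof -
    have "inner (a - b) (a - b) = 0" using that(3)[OF sub_diff[OF that(1,2)]] by (simp add: inner_diff_right)
    then show ?thesis by simp
  qed
  obtain P where P: "bounded_linear P" "\<And>x. P x \<in> S" "\<And>x. x \<in> S \<Longrightarrow> P x = x"
    "\<And>x y. y \<in> S \<Longrightarrow> inner (P x) y = inner x y"
    using orthogonal_projection[OF sub cl] by metis
  interpret P: bounded_linear P by (rule P(1))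
  have "\<exists>a\<in>S. \<forall>y\<in>S. \<beta> x y = inner y a" if x: "x \<in> S" for x
  proof (rule real_riesz[OF sub cl, of "\<lambda>y. \<beta> x y" "K * norm x"])
    show "\<bar>\<beta> x y\<bar> \<le> K * norm x * norm y" if "y \<in> S" for y using bound[OF x that] .
  qed (use x in \<open>auto simp: sym[OF x] sub_add sub_scale add scale\<close>)
  then obtain A\<^sub>0 where A\<^sub>0: "\<And>x. x \<in> S \<Longrightarrow> A\<^sub>0 x \<in> S"
    "\<And>x y. x \<in> S \<Longrightarrow> y \<in> S \<Longrightarrow> inner y (A\<^sub>0 x) = \<beta> x y"
    by metis
  define A where "A x = A\<^sub>0 (P x)" for x
  have A_S: "A x \<in> S" for x by (simp add: A_def A\<^sub>0 P)
  have A: "inner y (A x) = \<beta> (P x) y" if "y \<in> S" for x y by (simp add: A_def A\<^sub>0 P that)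
  have AP: "A (P x) = A x" for x by (simp add: A_def P)
  have "bounded_linear A"
  proof -
    obtain k where k: "\<And>x. norm (P x) \<le> norm x * k" using P.bounded by blast
    show ?thesis
    proof (rule bounded_linear_intro)
      fix x y :: 'a and r :: real
      show "A (x + y) = A x + A y"
        by (rule eq_in_S) (auto simp: A_S sub_add A P.add inner_add_right add P)
      show "A (r *\<^sub>R x) = r *\<^sub>R A x"
        by (rule eq_in_S) (auto simp: A_S sub_scale A P.scaleR scale P)
      have "norm (A x) * norm (A x) = \<beta> (P x) (A x)"
        using A[OF A_S, of x x] by (simp add: power2_norm_eq_inner[symmetric] power2_eq_square)
      also have "\<dots> \<le> K * norm (P x) * norm (A x)"
        using bound[OF P(2) A_S, of x x] by linarith
      also have "\<dots> \<le> \<bar>K\<bar> * norm (P x) * norm (A x)"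
        by (intro mult_right_mono) auto
      finally have "norm (A x) \<le> \<bar>K\<bar> * norm (P x)"
        by (cases "A x = 0") auto
      also have "\<dots> \<le> \<bar>K\<bar> * (norm x * k)"
        using k by (intro mult_left_mono) auto
      finally show "norm (A x) \<le> norm x * (\<bar>K\<bar> * k)" by (simp add: ac_simps)
    qed
  qed
  then interpret A: bounded_linear A .
  have A_sym: "inner (A x) y = inner x (A y)" for x y
  proof -
    have *: "inner (A x) y = \<beta> (P x) (P y)" for x y
      using P(4)[OF A_S, of y x] A[OF P(2), of y x] by (simp add: inner_commute)
    show ?thesis using *[of x y] *[of y x] sym[OF P(2) P(2)] by (simp add: inner_commute)
  qed
  have U_S: "u x \<in> S" if "u \<in> \<U>" "x \<in> S" for u x using U_onto that by blast
  have U_bl: "bounded_linear (\<lambda>x. u (P x))" if u: "u \<in> \<U>" for u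
  proof -
    obtain k where k: "\<And>x. norm (P x) \<le> norm x * k" using P.bounded by blast
    have "norm (u x) = norm x" if "x \<in> S" for x using U_inner[OF u that that] by (simp add: norm_eq_sqrt_inner)
    then show ?thesis
      by (intro bounded_linear_intro[where K = k]) (auto simp: P.add P.scaleR U_add U_scale u P k)
  qed
  have U_A: "u (P (A x)) = A (u (P x))" if u: "u \<in> \<U>" for u x
  proof (rule eq_in_S)
    fix y assume "y \<in> S"
    then obtain y' where y': "y' \<in> S" "y = u y'" using U_onto[OF u] by blast
    show "inner y (u (P (A x))) = inner y (A (u (P x)))"
      using y' A[OF U_S[OF u y'(1)]] A[OF y'(1)] by (simp add: U_inner u A_S P inv U_S)
  qed (auto simp: U_S u P A_S)
  have dichotomy: "(\<forall>x\<in>S. c * inner x x \<le> \<beta> x x) \<or> (\<forall>x\<in>S. \<beta> x x \<le> c * inner x x)" for c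
  proof -
    define B where "B x = A x - c *\<^sub>R x" for x
    have "bounded_linear B" unfolding B_def by (intro bounded_linear_intros A.bounded_linear_axioms)
    then interpret B: bounded_linear B .
    have B_sym: "inner (B x) y = inner x (B y)" for x y
      by (simp add: B_def inner_diff_left inner_diff_right A_sym)
    have B_S: "B x \<in> S" if "x \<in> S" for x using that by (simp add: B_def sub_diff sub_scale A_S)
    have B_form: "inner (B x) x = \<beta> x x - c * inner x x" if "x \<in> S" for x
      using that A[of x x] by (simp add: B_def inner_diff_left inner_diff_right P inner_commute)
    obtain D where D: "bounded_linear D" "\<And>x. D (D x) = B (B x)" "\<And>x. 0 \<le> inner (D x) x"
      "\<And>V x. bounded_linear V \<Longrightarrow> (\<And>y. V (B y) = B (V y)) \<Longrightarrow> V (D x) = D (V x)"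
      using absolute_value_operator[OF \<open>bounded_linear B\<close> B_sym] by metis
    interpret D: bounded_linear D by (rule D(1))
    have DU: "u (P (D x)) = D (u (P x))" if u: "u \<in> \<U>" for u x
    proof (rule D(4)[OF U_bl[OF u]])
      interpret u: bounded_linear "\<lambda>x. u (P x)" by (rule U_bl[OF u])
      show "u (P (B y)) = B (u (P y))" for y by (simp add: B_def u.diff u.scaleR U_A[OF u])
    qed
    have "P (D x) = D (P x)" for x
      by (rule D(4)[OF P(1)]) (simp add: B_def P.diff P.scaleR P(3)[OF A_S] AP)
    then have D_S: "D x \<in> S" if "x \<in> S" for x using P(2,3) that by metis
    have DB: "B (D x) = D (B x)" for x by (rule D(4)[OF B.bounded_linear_axioms]) simp
    \<comment> \<open>\<open>T\<close> is the kernel of the negative part of \<open>B\<close>; it contains the range of the positive part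
      \<open>D + B\<close> (up to the factor 2), since \<open>(D - B) (D + B) = 0\<close>.\<close>
    define T where "T = {x \<in> S. D x = B x}"
    have "T = {0} \<or> T = S"
    proof (rule irreducible)
      show "real_vector.subspace T"
        unfolding T_def by (rule real_vector.subspaceI)
          (auto simp: real_vector.subspace_0[OF sub] sub_add sub_scale D.zero B.zero D.add B.add D.scaleR B.scaleR)
      have "T = S \<inter> {x. D x = B x}" by (auto simp: T_def)
      also have "closed \<dots>"
        by (intro closed_Int cl closed_Collect_eq D.continuous_on B.continuous_on continuous_on_id)
      finally show "closed T" .
      show "T \<subseteq> S" by (auto simp: T_def)
      show "u ` T \<subseteq> T" if u: "u \<in> \<U>" for u
      proof
        fix y assume "y \<in> u ` T"
        then obtain x where x: "x \<in> S" "D x = B x" "y = u x" by (auto simp: T_def)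
        interpret u: bounded_linear "\<lambda>x. u (P x)" by (rule U_bl[OF u])
        have "D y = u (P (D x))" using DU[OF u, of x] x by (simp add: P)
        also have "\<dots> = B y" using U_A[OF u, of x] x by (simp add: B_def u.diff u.scaleR P(3)[OF x(1)])
        finally show "y \<in> T" using x U_S[OF u] by (simp add: T_def)
      qed
    qed
    then show ?thesis
    proof
      assume "T = S"
      then have "D x = B x" if "x \<in> S" for x using that unfolding T_def by blast
      then have "c * inner x x \<le> \<beta> x x" if "x \<in> S" for x using D(3)[of x] B_form that by simp
      then show ?thesis by blast
    next
      assume T: "T = {0}"
      have "\<beta> x x \<le> c * inner x x" if x: "x \<in> S" for x
      proof -
        have "D x + B x \<in> T"
          using x by (simp add: T_def sub_add D_S B_S D.add B.add D(2) DB)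
        then have "D x = - B x" using T by (simp add: eq_neg_iff_add_eq_0)
        then show ?thesis using D(3)[of x] B_form[OF x] by simp
      qed
      then show ?thesis by blast
    qed
  qed
  have "\<exists>c. \<forall>x\<in>S. \<beta> x x = c * inner x x"
  proof (cases "S \<subseteq> {0}")
    case True
    have "\<beta> x x = 0 * inner x x" if "x \<in> S" for x using scale[OF that that, of 0] True that by auto
    then show ?thesis by blast
  next
    case False
    then obtain x\<^sub>0 where x\<^sub>0: "x\<^sub>0 \<in> S" "x\<^sub>0 \<noteq> 0" by blast
    \<comment> \<open>Two different Rayleigh quotients would be separated by some \<open>c\<close> that violates the dichotomy.\<close>
    define q where "q x = \<beta> x x / inner x x" for x
    have q: "\<beta> x x = q x * inner x x" if "x \<noteq> 0" for x using that by (simp add: q_def)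
    have le: "q x \<le> q y" if "x \<in> S" "x \<noteq> 0" "y \<in> S" "y \<noteq> 0" for x y
    proof (rule ccontr)
      assume "\<not> q x \<le> q y"
      then obtain c where c: "q y < c" "c < q x" using dense by (metis linorder_not_le)
      have "c * inner x x < \<beta> x x" "\<beta> y y < c * inner y y"
        using c that by (simp_all add: q)
      moreover consider "\<forall>x\<in>S. c * inner x x \<le> \<beta> x x" | "\<forall>x\<in>S. \<beta> x x \<le> c * inner x x"
        using dichotomy by blast
      ultimately show False using that(1,3) by (metis linorder_not_le)
    qed
    have "\<beta> x x = q x\<^sub>0 * inner x x" if x: "x \<in> S" for x
    proof (cases "x = 0")
      case True
      then show ?thesis using scale[OF x x, of 0] by simp
    next
      case False
      then show ?thesis using le[OF x False x\<^sub>0] le[OF x\<^sub>0 x False] q[OF False] by simp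
    qed
    then show ?thesis by blast
  qed
  then obtain c where c: "\<And>x. x \<in> S \<Longrightarrow> \<beta> x x = c * inner x x" by blast
  have "\<beta> x y = c * inner x y" if xy: "x \<in> S" "y \<in> S" for x y
  proof -
    have "\<beta> (x + y) (x + y) = \<beta> x x + 2 * \<beta> x y + \<beta> y y"
      using add[OF xy sub_add[OF xy]] sym[OF sub_add[OF xy] xy(1)] sym[OF sub_add[OF xy] xy(2)]
        add[OF xy xy(1)] add[OF xy xy(2)] sym[OF xy] by linarith
    then show ?thesis
      using c[OF xy(1)] c[OF xy(2)] c[OF sub_add[OF xy]]
      by (simp add: inner_add_left inner_add_right inner_commute[of y x] algebra_simps)
  qed
  then show ?thesis by blast
qed


section \<open>Complex Hilbert spaces\<close>

lemma cinner_add_right: "cinner x (y + z) = cinner x y + cinner x z"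
  by (metis cinner_add_left cinner_commute complex_cnj_add)

lemma cinner_scaleC_right: "cinner x (c *\<^sub>C y) = cnj c * cinner x y"
  by (metis cinner_commute cinner_scaleC_left complex_cnj_mult)

lemma cinner_zero_left [simp]: "cinner 0 y = 0"
  using cinner_add_left[of 0 0 y] by simp

lemma cinner_diff_left: "cinner (x - y) z = cinner x z - cinner y z"
  using cinner_add_left[of "x - y" y z] by simp

lemma cinner_diff_right: "cinner x (y - z) = cinner x y - cinner x z"
  using cinner_add_right[of x "y - z" z] by simp

lemma cinner_self: "cinner x x = of_real ((norm x)\<^sup>2)"
proof (rule complex_eqI)
  show "Re (cinner x x) = Re (of_real ((norm x)\<^sup>2))"
    by (simp add: inner_eq_Re_cinner[symmetric] power2_norm_eq_inner)
  show "Im (cinner x x) = Im (of_real ((norm x)\<^sup>2))"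
    using arg_cong[OF cinner_commute[of x x], of Im] by simp
qed

lemma Im_cinner: "Im (cinner x y) = - Re (cinner (\<i> *\<^sub>C x) y)"
  by (simp add: cinner_scaleC_left)

lemma norm_scaleC: "norm (c *\<^sub>C x) = cmod c * norm (x :: 'a::complex_inner)"
proof -
  have "complex_of_real ((norm (c *\<^sub>C x))\<^sup>2) = (c * cnj c) * of_real ((norm x)\<^sup>2)"
    unfolding cinner_self[symmetric] by (simp add: cinner_scaleC_left cinner_scaleC_right)
  also have "\<dots> = of_real ((cmod c * norm x)\<^sup>2)"
    by (simp add: complex_norm_square[symmetric] power_mult_distrib)
  finally show ?thesis by (simp only: of_real_eq_iff power2_eq_iff_nonneg norm_ge_zero mult_nonneg_nonneg)
qed

text \<open>Multiplying \<open>x\<close> by a suitable phase makes the inner product real and nonnegative, which reduces the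
  complex Cauchy--Schwarz inequality to the real one.\<close>

lemma norm_cinner_le: "cmod (cinner x y) \<le> norm x * norm y"
proof (cases "cinner x y = 0")
  case False
  define u where "u = cnj (cinner x y) / of_real (cmod (cinner x y))"
  have u: "cmod u = 1" using False by (simp add: u_def norm_divide)
  have "cinner (u *\<^sub>C x) y = of_real (cmod (cinner x y))"
    using False by (simp add: cinner_scaleC_left u_def complex_norm_square[symmetric] power2_eq_square mult.commute)
  then have "cmod (cinner x y) = inner (u *\<^sub>C x) y" by (simp add: inner_eq_Re_cinner)
  also have "\<dots> \<le> norm (u *\<^sub>C x) * norm y" by (rule norm_cauchy_schwarz)
  finally show ?thesis by (simp add: norm_scaleC u)
qed simp

lemma bounded_linear_scaleC: "bounded_linear (\<lambda>x :: 'a::complex_inner. c *\<^sub>C x)"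
  by (rule bounded_linear_intro[where K = "cmod c"])
    (simp_all add: scaleC_add_right scaleR_scaleC norm_scaleC mult.commute)

lemma bounded_linear_cinner_left: "bounded_linear (\<lambda>x. cinner x y)"
  by (rule bounded_linear_intro[where K = "norm y"])
    (simp_all add: cinner_add_left scaleR_scaleC cinner_scaleC_left norm_cinner_le scaleC_complex_def)

lemma csubspace_imp_subspace:
  fixes S :: "'a::complex_inner set"
  shows "csubspace S \<Longrightarrow> real_vector.subspace S"
  unfolding real_vector.subspace_def complex_vector.subspace_def by (simp add: scaleR_scaleC)

lemma closed_csubspaceD:
  assumes "closed_csubspace S"
  shows "csubspace S" "closed S" "0 \<in> S" "real_vector.subspace S"
    and "\<And>x y. x \<in> S \<Longrightarrow> y \<in> S \<Longrightarrow> x + y \<in> S"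
    and "\<And>x y. x \<in> S \<Longrightarrow> y \<in> S \<Longrightarrow> x - y \<in> S"
    and "\<And>c x. x \<in> S \<Longrightarrow> c *\<^sub>C x \<in> S"
  using assms unfolding closed_csubspace_def
  by (auto intro: csubspace_imp_subspace complex_vector.subspace_0 complex_vector.subspace_add
      complex_vector.subspace_diff complex_vector.subspace_scale)

lemma closed_csubspace_closure_cspan: "closed_csubspace (closure (cspan (E :: 'a::complex_inner set)))"
proof -
  have S: "csubspace (cspan E)" by (rule complex_vector.subspace_span)
  have "x + y \<in> closure (cspan E)" if xy: "x \<in> closure (cspan E)" "y \<in> closure (cspan E)" for x y
  proof -
    obtain X where "\<And>n. X n \<in> cspan E" "X \<longlonglongrightarrow> x"
      using xy(1) unfolding closure_sequential by blast
    moreover obtain Y where "\<And>n. Y n \<in> cspan E" "Y \<longlonglongrightarrow> y"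
      using xy(2) unfolding closure_sequential by blast
    ultimately show ?thesis
      unfolding closure_sequential
      by (intro exI[of _ "\<lambda>n. X n + Y n"]) (auto intro: tendsto_add complex_vector.subspace_add[OF S])
  qed
  moreover have "0 \<in> closure (cspan E)"
    using complex_vector.subspace_0[OF S] closure_subset by blast
  moreover have "c *\<^sub>C x \<in> closure (cspan E)" if "x \<in> closure (cspan E)" for c x
  proof -
    have "(\<lambda>x. c *\<^sub>C x) ` closure (cspan E) \<subseteq> closure ((\<lambda>x. c *\<^sub>C x) ` cspan E)"
      by (rule closure_bounded_linear_image_subset[OF bounded_linear_scaleC])
    also have "\<dots> \<subseteq> closure (cspan E)"
      using complex_vector.subspace_scale[OF S] by (intro closure_mono) auto
    finally show ?thesis using that by blast
  qed
  ultimately show ?thesis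
    unfolding closed_csubspace_def complex_vector.subspace_def by simp
qed

lemma cinner_eq_0_closure_cspan:
  assumes "\<And>e. e \<in> E \<Longrightarrow> cinner e u = 0" and "z \<in> closure (cspan E)"
  shows "cinner z u = 0"
proof -
  let ?N = "{z. cinner z u = 0}"
  have "csubspace ?N"
    by (rule complex_vector.subspaceI) (auto simp: cinner_add_left cinner_scaleC_left)
  then have "cspan E \<subseteq> ?N" using assms(1) by (intro complex_vector.span_minimal) auto
  moreover have "closed ?N"
    by (intro closed_Collect_eq bounded_linear.continuous_on[OF bounded_linear_cinner_left]
        continuous_on_id continuous_on_const)
  ultimately have "closure (cspan E) \<subseteq> ?N" by (rule closure_minimal)
  with assms(2) show ?thesis by blast
qed

text \<open>Since \<open>f\<close> is complex linear, its real part at \<open>\<i> x\<close> determines its imaginary part at \<open>x\<close>, so it is enough to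
  represent the real part.\<close>

lemma complex_riesz:
  fixes S :: "'a::chilbert_space set" and f :: "'a \<Rightarrow> complex"
  assumes S: "closed_csubspace S"
    and add: "\<And>x y. x \<in> S \<Longrightarrow> y \<in> S \<Longrightarrow> f (x + y) = f x + f y"
    and scale: "\<And>c x. x \<in> S \<Longrightarrow> f (c *\<^sub>C x) = c * f x"
    and bound: "\<And>x. x \<in> S \<Longrightarrow> cmod (f x) \<le> K * norm x"
  shows "\<exists>y\<in>S. \<forall>x\<in>S. f x = cinner x y"
proof -
  have "\<exists>y\<in>S. \<forall>x\<in>S. Re (f x) = inner x y"
    by (rule real_riesz[OF closed_csubspaceD(4,2)[OF S], where K = K])
      (auto simp: add scaleR_scaleC scale intro: order_trans[OF abs_Re_le_cmod bound])
  then obtain y where y: "y \<in> S" "\<And>x. x \<in> S \<Longrightarrow> Re (f x) = Re (cinner x y)"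
    by (auto simp: inner_eq_Re_cinner)
  have "f x = cinner x y" if x: "x \<in> S" for x
  proof (rule complex_eqI)
    show "Im (f x) = Im (cinner x y)"
      using y(2)[OF closed_csubspaceD(7)[OF S x], of \<i>] by (simp add: Im_cinner scale x)
  qed (rule y(2)[OF x])
  with y(1) show ?thesis by blast
qed

lemma clinear_on_0: "clinear_on S T \<Longrightarrow> 0 \<in> S \<Longrightarrow> T 0 = 0"
  unfolding clinear_on_def by (metis complex_vector.scale_zero_left)

lemma clinear_on_diff:
  "clinear_on S T \<Longrightarrow> csubspace S \<Longrightarrow> x \<in> S \<Longrightarrow> y \<in> S \<Longrightarrow> T (x - y) = T x - T y"
proof -
  assume *: "clinear_on S T" "csubspace S" "x \<in> S" "y \<in> S"
  then have "T ((x - y) + y) = T (x - y) + T y"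
    unfolding clinear_on_def by (metis complex_vector.subspace_diff)
  then show ?thesis by simp
qed

lemma clinear_on_bounded:
  fixes T :: "'a::complex_inner \<Rightarrow> 'b::complex_inner"
  assumes S: "csubspace S" and T: "clinear_on S T" and cont: "continuous_on S T"
  obtains K where "0 \<le> K" "\<And>x. x \<in> S \<Longrightarrow> norm (T x) \<le> K * norm x"
proof -
  have 0: "0 \<in> S" using S by (rule complex_vector.subspace_0)
  have one: "(0::real) < 1" by simp
  have T0: "T 0 = 0" using clinear_on_0[OF T 0] .
  obtain d where d: "d > 0" "\<And>x. x \<in> S \<Longrightarrow> dist x 0 < d \<Longrightarrow> dist (T x) (T 0) < 1"
    using cont 0 one unfolding continuous_on_iff by blast
  have "norm (T x) \<le> (2 / d) * norm x" if x: "x \<in> S" for x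
  proof (cases "x = 0")
    case False
    define c where "c = complex_of_real (d / (2 * norm x))"
    have c: "cmod c = d / (2 * norm x)" unfolding c_def norm_of_real using d(1) by simp
    have "norm (c *\<^sub>C x) < d" using d(1) False by (simp add: norm_scaleC c)
    moreover have "c *\<^sub>C x \<in> S" using S x by (rule complex_vector.subspace_scale)
    ultimately have "norm (T (c *\<^sub>C x)) < 1" using d(2)[of "c *\<^sub>C x"] T0 by simp
    moreover have "T (c *\<^sub>C x) = c *\<^sub>C T x" using T x by (simp add: clinear_on_def)
    ultimately have "d / (2 * norm x) * norm (T x) < 1" by (simp add: norm_scaleC c)
    then show ?thesis using d(1) False by (simp add: field_simps)
  qed (simp add: T0)
  with d(1) that[of "2 / d"] show ?thesis by simp
qed

lemma continuous_on_if_clinear_on_bounded: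
  fixes T :: "'a::complex_inner \<Rightarrow> 'b::complex_inner"
  assumes S: "csubspace S" and T: "clinear_on S T" and bound: "\<And>x. x \<in> S \<Longrightarrow> norm (T x) \<le> K * norm x"
  shows "continuous_on S T"
proof -
  have "(max K 0)-lipschitz_on S T"
  proof (rule lipschitz_onI)
    fix x y assume xy: "x \<in> S" "y \<in> S"
    have "dist (T x) (T y) = norm (T (x - y))"
      using clinear_on_diff[OF T S xy] by (simp add: dist_norm)
    also have "\<dots> \<le> K * dist x y" 
      using bound[OF complex_vector.subspace_diff[OF S xy]] by (simp add: dist_norm)
    also have "\<dots> \<le> max K 0 * dist x y" by (intro mult_right_mono) auto
    finally show "dist (T x) (T y) \<le> max K 0 * dist x y" .
  qed simp
  then show ?thesis by (rule lipschitz_on_continuous_on)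
qed


section \<open>Schur's lemma\<close>

lemma unitary_repD:
  assumes "unitary_rep G \<rho>"
  shows "closed_csubspace (rep_space \<rho>)"
    and "\<And>g v. g \<in> carrier G \<Longrightarrow> v \<in> rep_space \<rho> \<Longrightarrow> rep_act \<rho> g v \<in> rep_space \<rho>"
    and "\<And>g. g \<in> carrier G \<Longrightarrow> rep_act \<rho> g ` rep_space \<rho> = rep_space \<rho>"
    and "\<And>g v w. g \<in> carrier G \<Longrightarrow> v \<in> rep_space \<rho> \<Longrightarrow> w \<in> rep_space \<rho> \<Longrightarrow>
      rep_act \<rho> g (v + w) = rep_act \<rho> g v + rep_act \<rho> g w"
    and "\<And>g c v. g \<in> carrier G \<Longrightarrow> v \<in> rep_space \<rho> \<Longrightarrow> rep_act \<rho> g (c *\<^sub>C v) = c *\<^sub>C rep_act \<rho> g v"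
    and "\<And>g v w. g \<in> carrier G \<Longrightarrow> v \<in> rep_space \<rho> \<Longrightarrow> w \<in> rep_space \<rho> \<Longrightarrow>
      cinner (rep_act \<rho> g v) (rep_act \<rho> g w) = cinner v w"
    and "\<And>v. v \<in> rep_space \<rho> \<Longrightarrow> rep_act \<rho> \<one>\<^bsub>G\<^esub> v = v"
  using assms unfolding unitary_rep_def unitary_map_def bij_betw_def clinear_on_def by blast+

lemma irreducible_repD:
  assumes "irreducible_rep G \<rho>"
  shows "unitary_rep G \<rho>" and "\<exists>x\<in>rep_space \<rho>. x \<noteq> 0"
    and "\<And>S. invariant_subspace G \<rho> S \<Longrightarrow> S = {0} \<or> S = rep_space \<rho>"
proof -
  show *: "unitary_rep G \<rho>" using assms by (simp add: irreducible_rep_def)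
  show "\<exists>x\<in>rep_space \<rho>. x \<noteq> 0"
    using assms closed_csubspaceD(3)[OF unitary_repD(1)[OF *]] by (auto simp: irreducible_rep_def)
qed (use assms in \<open>simp add: irreducible_rep_def\<close>)

text \<open>Multiplication by \<open>\<i>\<close> is orthogonal for the real inner product. Adjoined to the group action, it makes the
  closed invariant real subspaces exactly the closed invariant complex subspaces, so the real version of
  Schur's lemma applies to the real part of \<open>h\<close>.\<close>

lemma schur_hermitian_form:
  fixes \<rho> :: "('g, 'v::chilbert_space) rep" and h :: "'v \<Rightarrow> 'v \<Rightarrow> complex"
  assumes irr: "irreducible_rep G \<rho>"
    and add: "\<And>x y z. x \<in> rep_space \<rho> \<Longrightarrow> y \<in> rep_space \<rho> \<Longrightarrow> z \<in> rep_space \<rho> \<Longrightarrow>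
      h (x + y) z = h x z + h y z"
    and scale: "\<And>c x y. x \<in> rep_space \<rho> \<Longrightarrow> y \<in> rep_space \<rho> \<Longrightarrow> h (c *\<^sub>C x) y = c * h x y"
    and herm: "\<And>x y. x \<in> rep_space \<rho> \<Longrightarrow> y \<in> rep_space \<rho> \<Longrightarrow> h x y = cnj (h y x)"
    and bound: "\<And>x y. x \<in> rep_space \<rho> \<Longrightarrow> y \<in> rep_space \<rho> \<Longrightarrow> cmod (h x y) \<le> K * norm x * norm y"
    and inv: "\<And>g x y. g \<in> carrier G \<Longrightarrow> x \<in> rep_space \<rho> \<Longrightarrow> y \<in> rep_space \<rho> \<Longrightarrow>
      h (rep_act \<rho> g x) (rep_act \<rho> g y) = h x y"
  shows "\<exists>r::real. \<forall>x\<in>rep_space \<rho>. \<forall>y\<in>rep_space \<rho>. h x y = of_real r * cinner x y"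
proof -
  let ?S = "rep_space \<rho>"
  let ?\<U> = "insert (\<lambda>x. \<i> *\<^sub>C x) (rep_act \<rho> ` carrier G)"
  note \<rho> = unitary_repD[OF irreducible_repD(1)[OF irr]]
  note S = closed_csubspaceD[OF \<rho>(1)]
  have i_S: "(\<lambda>x. \<i> *\<^sub>C x) ` ?S = ?S"
  proof
    show "?S \<subseteq> (\<lambda>x. \<i> *\<^sub>C x) ` ?S"
    proof
      fix x assume "x \<in> ?S"
      then show "x \<in> (\<lambda>x. \<i> *\<^sub>C x) ` ?S" using S(7)[of x "- \<i>"]
        by (intro image_eqI[of _ _ "(- \<i>) *\<^sub>C x"]) simp_all
    qed
  qed (auto simp: S)
  have scale_right: "h x (c *\<^sub>C y) = cnj c * h x y" if "x \<in> ?S" "y \<in> ?S" for c x y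
    using herm[of x "c *\<^sub>C y"] herm[of x y] scale[of y x c] that by (simp add: S)
  have "\<exists>r. \<forall>x\<in>?S. \<forall>y\<in>?S. Re (h x y) = r * inner x y"
  proof (rule real_schur[OF S(4,2), of "\<lambda>x y. Re (h x y)" K ?\<U>])
    fix x y assume xy: "x \<in> ?S" "y \<in> ?S"
    show "Re (h x y) = Re (h y x)" using herm[OF xy] by simp
    show "\<bar>Re (h x y)\<bar> \<le> K * norm x * norm y"
      by (rule order_trans[OF abs_Re_le_cmod bound[OF xy]])
    fix u assume "u \<in> ?\<U>"
    then consider (i) "u = (\<lambda>x. \<i> *\<^sub>C x)" | (g) g where "g \<in> carrier G" "u = rep_act \<rho> g" by blast
    then show "u (x + y) = u x + u y" "inner (u x) (u y) = inner x y" "Re (h (u x) (u y)) = Re (h x y)"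
      using xy by (cases; simp add: \<rho> S inv scaleC_add_right inner_eq_Re_cinner cinner_scaleC_left
          cinner_scaleC_right scale scale_right)+
  next
    fix T
    assume T: "real_vector.subspace T" "closed T" "T \<subseteq> ?S" "\<And>u. u \<in> ?\<U> \<Longrightarrow> u ` T \<subseteq> T"
    have "c *\<^sub>C x \<in> T" if "x \<in> T" for c x
    proof -
      have "\<i> *\<^sub>C x \<in> T" using T(4)[of "\<lambda>x. \<i> *\<^sub>C x"] that by blast
      then have "Re c *\<^sub>R x + Im c *\<^sub>R (\<i> *\<^sub>C x) \<in> T"
        using that by (intro real_vector.subspace_add real_vector.subspace_scale T(1))
      also have "Re c *\<^sub>R x + Im c *\<^sub>R (\<i> *\<^sub>C x) = (of_real (Re c) + of_real (Im c) * \<i>) *\<^sub>C x"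
        by (simp add: scaleR_scaleC scaleC_add_left)
      also have "of_real (Re c) + of_real (Im c) * \<i> = c" by (simp add: complex_eq_iff)
      finally show ?thesis .
    qed
    then have "closed_csubspace T"
      using T(1,2) unfolding closed_csubspace_def complex_vector.subspace_def real_vector.subspace_def by simp
    then have "invariant_subspace G \<rho> T" using T(3,4) by (simp add: invariant_subspace_def)
    then show "T = {0} \<or> T = ?S" by (rule irreducible_repD(3)[OF irr])
  qed (use i_S in \<open>auto simp: add scaleR_scaleC scale \<rho>(2,3,5) mult.commute\<close>)
  then obtain r where r: "\<And>x y. x \<in> ?S \<Longrightarrow> y \<in> ?S \<Longrightarrow> Re (h x y) = r * Re (cinner x y)"
    by (auto simp: inner_eq_Re_cinner)
  have "h x y = of_real r * cinner x y" if xy: "x \<in> ?S" "y \<in> ?S" for x y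
  proof (rule complex_eqI)
    show "Im (h x y) = Im (of_real r * cinner x y)"
      using r[OF S(7)[OF xy(1)] xy(2), of \<i>] by (simp add: scale xy Im_cinner)
  qed (use r[OF xy] in simp)
  then show ?thesis by blast
qed

text \<open>A sesquilinear form is a complex combination of the two hermitian forms \<open>b + b\<^sup>*\<close> and \<open>\<i> (b - b\<^sup>*)\<close>.\<close>

lemma schur_form:
  fixes \<rho> :: "('g, 'v::chilbert_space) rep" and b :: "'v \<Rightarrow> 'v \<Rightarrow> complex"
  assumes irr: "irreducible_rep G \<rho>"
    and add_left: "\<And>x y z. x \<in> rep_space \<rho> \<Longrightarrow> y \<in> rep_space \<rho> \<Longrightarrow> z \<in> rep_space \<rho> \<Longrightarrow>
      b (x + y) z = b x z + b y z"
    and add_right: "\<And>x y z. x \<in> rep_space \<rho> \<Longrightarrow> y \<in> rep_space \<rho> \<Longrightarrow> z \<in> rep_space \<rho> \<Longrightarrow>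
      b x (y + z) = b x y + b x z"
    and scale_left: "\<And>c x y. x \<in> rep_space \<rho> \<Longrightarrow> y \<in> rep_space \<rho> \<Longrightarrow> b (c *\<^sub>C x) y = c * b x y"
    and scale_right: "\<And>c x y. x \<in> rep_space \<rho> \<Longrightarrow> y \<in> rep_space \<rho> \<Longrightarrow> b x (c *\<^sub>C y) = cnj c * b x y"
    and bound: "\<And>x y. x \<in> rep_space \<rho> \<Longrightarrow> y \<in> rep_space \<rho> \<Longrightarrow> cmod (b x y) \<le> K * norm x * norm y"
    and inv: "\<And>g x y. g \<in> carrier G \<Longrightarrow> x \<in> rep_space \<rho> \<Longrightarrow> y \<in> rep_space \<rho> \<Longrightarrow>
      b (rep_act \<rho> g x) (rep_act \<rho> g y) = b x y"
  shows "\<exists>c. \<forall>x\<in>rep_space \<rho>. \<forall>y\<in>rep_space \<rho>. b x y = c * cinner x y"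
proof -
  let ?S = "rep_space \<rho>"
  have bound': "cmod (b x y) + cmod (b y x) \<le> (2 * K) * norm x * norm y" if "x \<in> ?S" "y \<in> ?S" for x y
    using bound[OF that] bound[OF that(2,1)] by (simp add: algebra_simps)
  have "\<exists>r::real. \<forall>x\<in>?S. \<forall>y\<in>?S. b x y + cnj (b y x) = of_real r * cinner x y"
  proof (rule schur_hermitian_form[OF irr, where K = "2 * K"])
    show "cmod (b x y + cnj (b y x)) \<le> 2 * K * norm x * norm y" if "x \<in> ?S" "y \<in> ?S" for x y
      using norm_triangle_ineq[of "b x y" "cnj (b y x)"] bound'[OF that] by simp
  qed (simp_all add: add_left add_right scale_left scale_right inv algebra_simps)
  then obtain r :: real where r: "\<And>x y. x \<in> ?S \<Longrightarrow> y \<in> ?S \<Longrightarrow> b x y + cnj (b y x) = of_real r * cinner x y"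
    by blast
  have "\<exists>s::real. \<forall>x\<in>?S. \<forall>y\<in>?S. \<i> * (b x y - cnj (b y x)) = of_real s * cinner x y"
  proof (rule schur_hermitian_form[OF irr, where K = "2 * K"])
    show "cmod (\<i> * (b x y - cnj (b y x))) \<le> 2 * K * norm x * norm y" if "x \<in> ?S" "y \<in> ?S" for x y
      using norm_triangle_ineq4[of "b x y" "cnj (b y x)"] bound'[OF that] by (simp add: norm_mult)
  qed (simp_all add: add_left add_right scale_left scale_right inv algebra_simps)
  then obtain s :: real where s: "\<And>x y. x \<in> ?S \<Longrightarrow> y \<in> ?S \<Longrightarrow> \<i> * (b x y - cnj (b y x)) = of_real s * cinner x y"
    by blast
  have "b x y = ((of_real r - \<i> * of_real s) / 2) * cinner x y" if "x \<in> ?S" "y \<in> ?S" for x y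
  proof -
    have "b x y * 2 = (b x y + cnj (b y x)) - \<i> * (\<i> * (b x y - cnj (b y x)))"
      by (simp add: algebra_simps)
    also have "\<dots> = (of_real r - \<i> * of_real s) * cinner x y"
      unfolding r[OF that] s[OF that] by (simp add: algebra_simps)
    finally show ?thesis by simp
  qed
  then show ?thesis by blast
qed


section \<open>Equivalence of representations\<close>

lemma unitary_map_inv:
  assumes U: "unitary_map S T U" and S: "csubspace S"
  shows "unitary_map T S (inv_into S U)"
proof -
  let ?V = "inv_into S U"
  have bij: "bij_betw U S T" and lin: "clinear_on S U" and iso: "\<And>x y. x \<in> S \<Longrightarrow> y \<in> S \<Longrightarrow> cinner (U x) (U y) = cinner x y"
    using U by (auto simp: unitary_map_def)
  have V: "?V y \<in> S" "U (?V y) = y" if "y \<in> T" for y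
    using bij that by (auto simp: bij_betw_def inv_into_into f_inv_into_f)
  have VU: "?V (U x) = x" if "x \<in> S" for x
    using bij that by (simp add: bij_betw_def)
  have "?V (x + y) = ?V x + ?V y" if "x \<in> T" "y \<in> T" for x y
    using VU[OF complex_vector.subspace_add[OF S V(1)[OF that(1)] V(1)[OF that(2)]]] lin V that
    by (simp add: clinear_on_def)
  moreover have "?V (c *\<^sub>C x) = c *\<^sub>C ?V x" if "x \<in> T" for c x
    using VU[OF complex_vector.subspace_scale[OF S V(1)[OF that], of c]] lin V that
    by (simp add: clinear_on_def)
  ultimately have "clinear_on T ?V" by (simp add: clinear_on_def)
  moreover have "cinner (?V x) (?V y) = cinner x y" if "x \<in> T" "y \<in> T" for x y
    using iso[OF V(1)[OF that(1)] V(1)[OF that(2)]] V(2) that by simp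
  ultimately show ?thesis
    using bij_betw_inv_into[OF bij] by (simp add: unitary_map_def)
qed

lemma rep_equiv_sym:
  assumes \<rho>: "unitary_rep G \<rho>" and eq: "rep_equiv G \<rho> \<sigma>"
  shows "rep_equiv G \<sigma> \<rho>"
proof -
  obtain U where U: "unitary_map (rep_space \<rho>) (rep_space \<sigma>) U"
    "\<And>g v. g \<in> carrier G \<Longrightarrow> v \<in> rep_space \<rho> \<Longrightarrow> U (rep_act \<rho> g v) = rep_act \<sigma> g (U v)"
    using eq unfolding rep_equiv_def by blast
  let ?V = "inv_into (rep_space \<rho>) U"
  have bij: "bij_betw U (rep_space \<rho>) (rep_space \<sigma>)" using U(1) by (simp add: unitary_map_def)
  have "?V (rep_act \<sigma> g w) = rep_act \<rho> g (?V w)" if g: "g \<in> carrier G" and w: "w \<in> rep_space \<sigma>" for g w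
  proof -
    have V: "?V w \<in> rep_space \<rho>" "U (?V w) = w"
      using bij w by (auto simp: bij_betw_def inv_into_into f_inv_into_f)
    have "?V (U (rep_act \<rho> g (?V w))) = rep_act \<rho> g (?V w)"
      using bij unitary_repD(2)[OF \<rho> g V(1)] by (simp add: bij_betw_def)
    with U(2)[OF g V(1)] V(2) show ?thesis by simp
  qed
  moreover have "unitary_map (rep_space \<sigma>) (rep_space \<rho>) ?V"
    by (rule unitary_map_inv[OF U(1) closed_csubspaceD(1)[OF unitary_repD(1)[OF \<rho>]]])
  ultimately show ?thesis unfolding rep_equiv_def by blast
qed

lemma rep_equiv_trans:
  assumes "rep_equiv G \<rho> \<sigma>" "rep_equiv G \<sigma> \<tau>"
  shows "rep_equiv G \<rho> \<tau>"
proof -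
  obtain U where U: "unitary_map (rep_space \<rho>) (rep_space \<sigma>) U"
    "\<And>g v. g \<in> carrier G \<Longrightarrow> v \<in> rep_space \<rho> \<Longrightarrow> U (rep_act \<rho> g v) = rep_act \<sigma> g (U v)"
    using assms(1) unfolding rep_equiv_def by blast
  obtain V where V: "unitary_map (rep_space \<sigma>) (rep_space \<tau>) V"
    "\<And>g v. g \<in> carrier G \<Longrightarrow> v \<in> rep_space \<sigma> \<Longrightarrow> V (rep_act \<sigma> g v) = rep_act \<tau> g (V v)"
    using assms(2) unfolding rep_equiv_def by blast
  have U_in: "U v \<in> rep_space \<sigma>" if "v \<in> rep_space \<rho>" for v
    using U(1) that by (auto simp: unitary_map_def bij_betw_def)
  have "unitary_map (rep_space \<rho>) (rep_space \<tau>) (V \<circ> U)"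
    using U(1) V(1) U_in unfolding unitary_map_def clinear_on_def
    by (auto intro: bij_betw_trans)
  moreover have "(V \<circ> U) (rep_act \<rho> g v) = rep_act \<tau> g ((V \<circ> U) v)"
    if "g \<in> carrier G" "v \<in> rep_space \<rho>" for g v
    using that U(2) V(2) U_in by simp
  ultimately show ?thesis unfolding rep_equiv_def by blast
qed

lemma isotypic_component_cong:
  fixes R :: "('g, 'f::chilbert_space) rep"
  assumes "unitary_rep G \<sigma>" "rep_equiv G \<sigma> \<sigma>'"
  shows "isotypic_component G R \<sigma> = isotypic_component G R \<sigma>'"
proof -
  have "rep_equiv G \<rho> \<sigma> \<longleftrightarrow> rep_equiv G \<rho> \<sigma>'" for \<rho> :: "('g, 'f) rep"
    using rep_equiv_trans[OF _ assms(2)] rep_equiv_trans[OF _ rep_equiv_sym[OF assms]] by (rule iffI)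
  then show ?thesis by (simp add: isotypic_component_def)
qed


section \<open>Intertwining maps out of an irreducible representation\<close>

lemma rep_space_subrep [simp]: "rep_space (subrep \<rho> S) = S"
  and rep_act_subrep [simp]: "rep_act (subrep \<rho> S) = rep_act \<rho>"
  by (simp_all add: subrep_def)

lemma Hom_repD:
  assumes "T \<in> Hom_rep K \<rho> \<sigma>"
  shows "\<And>x. x \<in> rep_space \<rho> \<Longrightarrow> T x \<in> rep_space \<sigma>"
    and "clinear_on (rep_space \<rho>) T" and "continuous_on (rep_space \<rho>) T"
    and "\<And>x y. x \<in> rep_space \<rho> \<Longrightarrow> y \<in> rep_space \<rho> \<Longrightarrow> T (x + y) = T x + T y"
    and "\<And>c x. x \<in> rep_space \<rho> \<Longrightarrow> T (c *\<^sub>C x) = c *\<^sub>C T x"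
    and "\<And>g x. g \<in> carrier K \<Longrightarrow> x \<in> rep_space \<rho> \<Longrightarrow> T (rep_act \<rho> g x) = rep_act \<sigma> g (T x)"
    and "\<And>x. x \<notin> rep_space \<rho> \<Longrightarrow> T x = 0"
  using assms by (auto simp: Hom_rep_def clinear_on_def)

lemma Hom_rep_bounded:
  assumes "T \<in> Hom_rep K \<rho> \<sigma>" "closed_csubspace (rep_space \<rho>)"
  obtains k where "0 \<le> k" "\<And>x. x \<in> rep_space \<rho> \<Longrightarrow> norm (T x) \<le> k * norm x"
  using clinear_on_bounded[OF closed_csubspaceD(1)[OF assms(2)] Hom_repD(2,3)[OF assms(1)]]
  by (metis that)

text \<open>Schur's lemma for the form \<open>\<langle>T x, T y\<rangle>\<close>: it is invariant because the group acts unitarily on both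
  sides.\<close>

lemma Hom_rep_scaled_isometry:
  assumes irr: "irreducible_rep K \<rho>" and R: "unitary_rep K R" and T: "T \<in> Hom_rep K \<rho> R"
  obtains r where "0 \<le> r" "\<And>x y. x \<in> rep_space \<rho> \<Longrightarrow> y \<in> rep_space \<rho> \<Longrightarrow>
    cinner (T x) (T y) = of_real (r\<^sup>2) * cinner x y"
proof -
  note \<rho> = unitary_repD[OF irreducible_repD(1)[OF irr]]
  note T' = Hom_repD[OF T]
  obtain k where k: "0 \<le> k" "\<And>x. x \<in> rep_space \<rho> \<Longrightarrow> norm (T x) \<le> k * norm x"
    using Hom_rep_bounded[OF T \<rho>(1)] by blast
  have "\<exists>c. \<forall>x\<in>rep_space \<rho>. \<forall>y\<in>rep_space \<rho>. cinner (T x) (T y) = c * cinner x y"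
  proof (rule schur_form[OF irr, where K = "k * k"])
    fix x y assume xy: "x \<in> rep_space \<rho>" "y \<in> rep_space \<rho>"
    have "cmod (cinner (T x) (T y)) \<le> norm (T x) * norm (T y)" by (rule norm_cinner_le)
    also have "\<dots> \<le> (k * norm x) * (k * norm y)"
      using k xy by (intro mult_mono) auto
    finally show "cmod (cinner (T x) (T y)) \<le> k * k * norm x * norm y" by (simp add: ac_simps)
  qed (simp_all add: T' unitary_repD(6)[OF R] cinner_add_left cinner_add_right cinner_scaleC_left cinner_scaleC_right)
  then obtain c where c: "\<And>x y. x \<in> rep_space \<rho> \<Longrightarrow> y \<in> rep_space \<rho> \<Longrightarrow> cinner (T x) (T y) = c * cinner x y"
    by blast
  obtain x where x: "x \<in> rep_space \<rho>" "x \<noteq> 0" using irreducible_repD(2)[OF irr] by blast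
  have "of_real ((norm (T x))\<^sup>2) = c * of_real ((norm x)\<^sup>2)"
    using c[OF x(1) x(1)] by (simp only: cinner_self)
  then have "c = of_real ((norm (T x) / norm x)\<^sup>2)"
    using x(2) by (simp add: field_simps power_divide)
  with c show ?thesis using that[of "norm (T x) / norm x"] by simp
qed

text \<open>Unless \<open>T\<close> vanishes, it is a positive multiple of an isometry. Its range is then closed, it is an
  irreducible subrepresentation of \<open>R\<close> equivalent to \<open>\<rho>\<close>, and hence one of the subspaces that span the isotypic
  component.\<close>

lemma Hom_rep_image_subset_isotypic:
  fixes \<rho> :: "('g, 'v::chilbert_space) rep" and R :: "('g, 'f::chilbert_space) rep"
  assumes irr: "irreducible_rep K \<rho>" and R: "unitary_rep K R" and T: "T \<in> Hom_rep K \<rho> R"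
  shows "T ` rep_space \<rho> \<subseteq> isotypic_component K R \<rho>"
proof -
  let ?X = "rep_space \<rho>"
  define S where "S = T ` ?X"
  note unitary_\<rho> = irreducible_repD(1)[OF irr]
  note \<rho> = unitary_repD[OF unitary_\<rho>] and R' = unitary_repD[OF R] and T' = Hom_repD[OF T]
  note X = closed_csubspaceD[OF \<rho>(1)]
  obtain r where r: "0 \<le> r" "\<And>x y. x \<in> ?X \<Longrightarrow> y \<in> ?X \<Longrightarrow> cinner (T x) (T y) = of_real (r\<^sup>2) * cinner x y"
    using Hom_rep_scaled_isometry[OF irr R T] by blast
  have norm_T: "norm (T x) = r * norm x" if "x \<in> ?X" for x
  proof -
    have "complex_of_real ((norm (T x))\<^sup>2) = of_real ((r * norm x)\<^sup>2)"
      using r(2)[OF that that] by (simp only: cinner_self power_mult_distrib of_real_mult)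
    then show ?thesis using r(1) by (simp only: of_real_eq_iff power2_eq_iff_nonneg norm_ge_zero mult_nonneg_nonneg)
  qed
  have "S \<subseteq> isotypic_component K R \<rho>"
  proof (cases "r = 0")
    case True
    then have "S \<subseteq> {0}" using norm_T by (auto simp: S_def)
    also have "\<dots> \<subseteq> isotypic_component K R \<rho>"
      unfolding isotypic_component_def using closed_csubspaceD(3)[OF closed_csubspace_closure_cspan] by blast
    finally show ?thesis .
  next
    case False
    with r(1) have r0: "r > 0" by simp
    have dist_T: "dist (T x) (T y) = r * dist x y" if "x \<in> ?X" "y \<in> ?X" for x y
      using norm_T[OF X(6)[OF that]] clinear_on_diff[OF T'(2) X(1) that] by (simp add: dist_norm)
    have sub_S: "csubspace S"
    proof (rule complex_vector.subspaceI)
      show "0 \<in> S" using clinear_on_0[OF T'(2) X(3)] X(3) by (auto simp: S_def intro!: image_eqI[of _ _ 0])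
    next
      fix a b assume "a \<in> S" "b \<in> S"
      then obtain x y where "x \<in> ?X" "y \<in> ?X" "a = T x" "b = T y" unfolding S_def by blast
      then show "a + b \<in> S" unfolding S_def by (intro image_eqI[of _ _ "x + y"]) (simp_all add: T'(4) X(5))
    next
      fix c a assume "a \<in> S"
      then obtain x where "x \<in> ?X" "a = T x" unfolding S_def by blast
      then show "c *\<^sub>C a \<in> S" unfolding S_def by (intro image_eqI[of _ _ "c *\<^sub>C x"]) (simp_all add: T'(5) X(7))
    qed
    have "closed S"
      unfolding closed_sequential_limits
    proof (intro allI impI, elim conjE)
      fix s z assume s: "\<forall>n. s n \<in> S" "s \<longlonglongrightarrow> z"
      from s(1) have "\<forall>n. \<exists>u. u \<in> ?X \<and> s n = T u" unfolding S_def by blast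
      then obtain u where u: "\<And>n. u n \<in> ?X" "\<And>n. s n = T (u n)" using choice by metis
      have "Cauchy u"
      proof (rule metric_CauchyI)
        fix e :: real assume "0 < e"
        then obtain N where "\<And>i j. i \<ge> N \<Longrightarrow> j \<ge> N \<Longrightarrow> dist (s i) (s j) < r * e"
          using metric_CauchyD[OF LIMSEQ_imp_Cauchy[OF s(2)], of "r * e"] r0 by auto
        then show "\<exists>N. \<forall>i\<ge>N. \<forall>j\<ge>N. dist (u i) (u j) < e"
          using r0 by (auto simp: u(2) dist_T u(1))
      qed
      then obtain x where x: "u \<longlonglongrightarrow> x" using Cauchy_convergent convergent_def by blast
      then have xX: "x \<in> ?X" using closed_sequentially[OF X(2) _ x] u(1) by blast
      have "(\<lambda>n. T (u n)) \<longlonglongrightarrow> T x"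
        by (rule continuous_on_tendsto_compose[OF T'(3) x xX]) (simp add: u(1))
      then have "z = T x" using s(2) LIMSEQ_unique by (simp add: u(2)[symmetric])
      with xX show "z \<in> S" by (simp add: S_def)
    qed
    with sub_S have S: "closed_csubspace S" by (simp add: closed_csubspace_def)
    have S_R: "a \<in> rep_space R" if "a \<in> S" for a using T'(1) that unfolding S_def by blast
    have act_S: "rep_act R g ` S = S" if g: "g \<in> carrier K" for g
    proof -
      have "rep_act R g ` S = T ` (rep_act \<rho> g ` ?X)"
        unfolding S_def image_image using T'(6)[OF g] by (intro image_cong) simp_all
      then show ?thesis using \<rho>(3)[OF g] by (simp add: S_def)
    qed
    have "unitary_rep K (subrep R S)"
    proof -
      have "unitary_map S S (rep_act R g)" if g: "g \<in> carrier K" for g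
      proof -
        have inj: "inj_on (rep_act R g) S"
        proof (rule inj_onI)
          fix a b assume *: "a \<in> S" "b \<in> S" "rep_act R g a = rep_act R g b"
          have ab: "a \<in> rep_space R" "b \<in> rep_space R" using S_R *(1,2) by simp_all
          have "cinner (a - b) (a - b) = 0"
            using *(3) R'(6)[OF g ab(1) ab(1)] R'(6)[OF g ab(1) ab(2)] R'(6)[OF g ab(2) ab(1)] R'(6)[OF g ab(2) ab(2)]
            by (simp add: cinner_diff_left cinner_diff_right)
          then show "a = b" by (simp add: cinner_self)
        qed
        have lin: "clinear_on S (rep_act R g)"
          unfolding clinear_on_def by (simp add: R'(4,5)[OF g] S_R)
        have iso: "\<forall>a\<in>S. \<forall>b\<in>S. cinner (rep_act R g a) (rep_act R g b) = cinner a b"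
          by (simp add: R'(6)[OF g] S_R)
        show ?thesis
          unfolding unitary_map_def bij_betw_def by (intro conjI inj act_S[OF g] lin iso)
      qed
      moreover have "rep_act R (g \<otimes>\<^bsub>K\<^esub> h) v = rep_act R g (rep_act R h v)"
        if "g \<in> carrier K" "h \<in> carrier K" "v \<in> S" for g h v
      proof -
        have "v \<in> rep_space R" using that(3) by (rule S_R)
        with R that(1,2) show ?thesis by (simp add: unitary_rep_def)
      qed
      moreover have "continuous_map (gtop K) euclidean (\<lambda>g. rep_act R g v)" if "v \<in> S" for v
      proof -
        have "v \<in> rep_space R" using that by (rule S_R)
        with R show ?thesis by (simp add: unitary_rep_def)
      qed
      moreover have "rep_act R \<one>\<^bsub>K\<^esub> v = v" if "v \<in> S" for v
        by (rule R'(7)[OF S_R[OF that]])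
      ultimately show ?thesis
        using S by (simp add: unitary_rep_def)
    qed
    moreover have "S \<noteq> {0}"
    proof -
      obtain x where x: "x \<in> ?X" "x \<noteq> 0" using irreducible_repD(2)[OF irr] by blast
      then have "T x \<noteq> 0" using norm_T[of x] r0 by auto
      with x(1) show ?thesis unfolding S_def by blast
    qed
    moreover have "Q = {0} \<or> Q = S" if Q: "invariant_subspace K (subrep R S) Q" for Q
    proof -
      have Q': "closed_csubspace Q" "Q \<subseteq> S" "\<And>g. g \<in> carrier K \<Longrightarrow> rep_act R g ` Q \<subseteq> Q"
        using Q by (auto simp: invariant_subspace_def)
      note Q'' = closed_csubspaceD[OF Q'(1)]
      define P where "P = {x \<in> ?X. T x \<in> Q}"
      have "csubspace P"
        unfolding P_def using clinear_on_0[OF T'(2) X(3)]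
        by (intro complex_vector.subspaceI) (auto simp: X Q'' T')
      moreover have "closed P"
        using continuous_closed_preimage[OF T'(3) X(2) Q''(2)] by (simp add: P_def vimage_def Int_def)
      moreover have "rep_act \<rho> g ` P \<subseteq> P" if "g \<in> carrier K" for g
        using Q'(3)[OF that] \<rho>(2)[OF that] T'(6)[OF that] by (auto simp: P_def)
      ultimately have "invariant_subspace K \<rho> P"
        by (auto simp: invariant_subspace_def closed_csubspace_def P_def)
      then have "P = {0} \<or> P = ?X" by (rule irreducible_repD(3)[OF irr])
      moreover have "Q = T ` P" using Q'(2) by (auto simp: P_def S_def)
      ultimately show ?thesis using clinear_on_0[OF T'(2) X(3)] by (auto simp: S_def)
    qed
    ultimately have irr_S: "irreducible_rep K (subrep R S)"
      by (simp add: irreducible_rep_def)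
    define V where "V x = of_real (1 / r) *\<^sub>C T x" for x
    have "unitary_map ?X S V"
      unfolding unitary_map_def
    proof (intro conjI ballI)
      have iso: "cinner (V x) (V y) = cinner x y" if "x \<in> ?X" "y \<in> ?X" for x y
        using r0 by (simp add: V_def cinner_scaleC_left cinner_scaleC_right r(2)[OF that] power2_eq_square)
      then show "cinner (V x) (V y) = cinner x y" if "x \<in> ?X" "y \<in> ?X" for x y using that .
      show lin: "clinear_on ?X V"
        unfolding clinear_on_def V_def by (simp add: T' scaleC_add_right mult.commute)
      have "V ` ?X = T ` ((\<lambda>x. of_real (1 / r) *\<^sub>C x) ` ?X)"
        unfolding V_def image_image using T'(5) by (intro image_cong) auto
      also have "(\<lambda>x. of_real (1 / r) *\<^sub>C x) ` ?X = ?X"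
      proof
        show "?X \<subseteq> (\<lambda>x. of_real (1 / r) *\<^sub>C x) ` ?X"
        proof
          fix x assume "x \<in> ?X"
          then show "x \<in> (\<lambda>x. of_real (1 / r) *\<^sub>C x) ` ?X"
            using r0 X(7)[of x "of_real r"]
            by (intro image_eqI[of _ _ "of_real r *\<^sub>C x"]) simp_all
        qed
      qed (auto simp: X)
      finally have "V ` ?X = S" by (simp only: S_def)
      moreover have "inj_on V ?X"
      proof (rule inj_onI)
        fix x y assume xy: "x \<in> ?X" "y \<in> ?X" "V x = V y"
        have "cinner (x - y) (x - y) = cinner (V (x - y)) (V (x - y))" using iso X(6)[OF xy(1,2)] by simp
        also have "V (x - y) = 0" using clinear_on_diff[OF lin X(1) xy(1,2)] xy(3) by simp
        finally show "x = y" by (simp add: cinner_self)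
      qed
      ultimately show "bij_betw V ?X S" by (simp add: bij_betw_def)
    qed
    moreover have "V (rep_act \<rho> g x) = rep_act R g (V x)" if "g \<in> carrier K" "x \<in> ?X" for g x
      using that by (simp add: V_def T' R')
    ultimately have "rep_equiv K \<rho> (subrep R S)"
      unfolding rep_equiv_def by auto
    then have "rep_equiv K (subrep R S) \<rho>" by (rule rep_equiv_sym[OF unitary_\<rho>])
    with irr_S S_R subsetI have "S \<in> {S. S \<subseteq> rep_space R \<and> irreducible_rep K (subrep R S) \<and> rep_equiv K (subrep R S) \<rho>}"
      by blast
    then have "S \<subseteq> cspan (\<Union>{S. S \<subseteq> rep_space R \<and> irreducible_rep K (subrep R S) \<and> rep_equiv K (subrep R S) \<rho>})"
      using complex_vector.span_superset by (meson Union_upper subset_trans)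
    then show ?thesis
      unfolding isotypic_component_def using closure_subset by (rule subset_trans)
  qed
  then show ?thesis by (simp only: S_def)
qed


section \<open>Tensor products\<close>

lemma hilbert_tensor_productD:
  assumes "hilbert_tensor_product V W I \<tau>"
  shows "\<And>v v' w. v \<in> V \<Longrightarrow> v' \<in> V \<Longrightarrow> w \<in> W \<Longrightarrow> \<tau> (v + v') w = \<tau> v w + \<tau> v' w"
    and "\<And>c v w. v \<in> V \<Longrightarrow> w \<in> W \<Longrightarrow> \<tau> (c *\<^sub>C v) w = c *\<^sub>C \<tau> v w"
    and "\<And>v w w'. v \<in> V \<Longrightarrow> w \<in> W \<Longrightarrow> w' \<in> W \<Longrightarrow> \<tau> v (w + w') = \<tau> v w + \<tau> v w'"
    and "\<And>c v w. v \<in> V \<Longrightarrow> w \<in> W \<Longrightarrow> \<tau> v (c *\<^sub>C w) = c *\<^sub>C \<tau> v w"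
    and "\<And>v w v' w'. v \<in> V \<Longrightarrow> w \<in> W \<Longrightarrow> v' \<in> V \<Longrightarrow> w' \<in> W \<Longrightarrow>
      cinner (\<tau> v w) (\<tau> v' w') = cinner v v' * cinner w w'"
    and "I = closure (cspan {\<tau> v w | v w. v \<in> V \<and> w \<in> W})"
    and "\<And>v w. v \<in> V \<Longrightarrow> w \<in> W \<Longrightarrow> \<tau> v w \<in> I"
proof -
  show I: "I = closure (cspan {\<tau> v w | v w. v \<in> V \<and> w \<in> W})"
    using assms by (simp add: hilbert_tensor_product_def)
  show "\<tau> v w \<in> I" if "v \<in> V" "w \<in> W" for v w
    unfolding I by (rule subsetD[OF closure_subset], rule complex_vector.span_base) (use that in blast)
qed (use assms in \<open>auto simp: hilbert_tensor_product_def clinear_on_def\<close>)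

lemma norm_tensor:
  assumes "hilbert_tensor_product V W I \<tau>" "v \<in> V" "w \<in> W"
  shows "norm (\<tau> v w) = norm v * norm w"
proof -
  have "complex_of_real ((norm (\<tau> v w))\<^sup>2) = of_real ((norm v * norm w)\<^sup>2)"
    using hilbert_tensor_productD(5)[OF assms(1,2,3,2,3)]
    by (simp only: cinner_self power_mult_distrib of_real_mult)
  then show ?thesis by (simp only: of_real_eq_iff power2_eq_iff_nonneg norm_ge_zero mult_nonneg_nonneg)
qed

text \<open>This makes the vector \<open>S w\<close> in \<open>\<tau> (T x) w = \<sigma> x (S w)\<close> unique, and with it the linearity and the
  equivariance of \<open>S\<close> automatic.\<close>

lemma tensor_cancel_left:
  assumes \<tau>: "hilbert_tensor_product V W I \<tau>" and W: "csubspace W"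
    and v: "v \<in> V" "v \<noteq> 0" and w: "w \<in> W" "w' \<in> W" and eq: "\<tau> v w = \<tau> v w'"
  shows "w = w'"
proof -
  have lin: "clinear_on W (\<tau> v)" using \<tau> v(1) by (simp add: hilbert_tensor_product_def)
  have "\<tau> v (w - w') = 0" using clinear_on_diff[OF lin W w] eq by simp
  then have "norm v * norm (w - w') = 0"
    using norm_tensor[OF \<tau> v(1) complex_vector.subspace_diff[OF W w]] by simp
  with v(2) show ?thesis by simp
qed

lemma hilbert_tensor_product_swap:
  assumes "hilbert_tensor_product V W I \<tau>"
  shows "hilbert_tensor_product W V I (\<lambda>w v. \<tau> v w)"
proof -
  have "{\<tau> v w |w v. w \<in> W \<and> v \<in> V} = {\<tau> v w |v w. v \<in> V \<and> w \<in> W}" by blast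
  then show ?thesis using assms by (simp add: hilbert_tensor_product_def mult.commute)
qed

lemma hilbert_tensor_product_unitary:
  assumes \<tau>: "hilbert_tensor_product V W I \<tau>" and U: "unitary_map V\<^sub>0 V U" and U': "unitary_map W\<^sub>0 W U'"
  shows "hilbert_tensor_product V\<^sub>0 W\<^sub>0 I (\<lambda>v w. \<tau> (U v) (U' w))"
proof -
  have U_in: "U v \<in> V" if "v \<in> V\<^sub>0" for v using U that by (auto simp: unitary_map_def bij_betw_def)
  have U'_in: "U' w \<in> W" if "w \<in> W\<^sub>0" for w using U' that by (auto simp: unitary_map_def bij_betw_def)
  have onto: "V = U ` V\<^sub>0" "W = U' ` W\<^sub>0" using U U' by (auto simp: unitary_map_def bij_betw_def)
  have "{\<tau> (U v) (U' w) |v w. v \<in> V\<^sub>0 \<and> w \<in> W\<^sub>0} = {\<tau> v w |v w. v \<in> V \<and> w \<in> W}"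
    unfolding onto by blast
  then have "closure (cspan {\<tau> (U v) (U' w) |v w. v \<in> V\<^sub>0 \<and> w \<in> W\<^sub>0}) = I"
    using hilbert_tensor_productD(6)[OF \<tau>] by metis
  moreover have "clinear_on V\<^sub>0 U" "clinear_on W\<^sub>0 U'"
    and "\<And>x y. x \<in> V\<^sub>0 \<Longrightarrow> y \<in> V\<^sub>0 \<Longrightarrow> cinner (U x) (U y) = cinner x y"
    and "\<And>x y. x \<in> W\<^sub>0 \<Longrightarrow> y \<in> W\<^sub>0 \<Longrightarrow> cinner (U' x) (U' y) = cinner x y"
    using U U' by (auto simp: unitary_map_def)
  ultimately show ?thesis
    unfolding hilbert_tensor_product_def clinear_on_def
    by (simp add: U_in U'_in hilbert_tensor_productD(1-5)[OF \<tau>])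
qed

text \<open>Every intertwining map from \<open>\<rho>\<close> into \<open>\<rho> \<otimes> Y\<close>, where the group acts on the first factor only, is
  \<open>x \<mapsto> x \<otimes> y\<close>. For fixed \<open>y'\<close>, Schur's lemma gives \<open>\<langle>T x, x' \<otimes> y'\<rangle> = c y' * \<langle>x, x'\<rangle>\<close>. The scalar \<open>c y'\<close> is a
  bounded antilinear function of \<open>y'\<close>, so it is \<open>\<langle>y, y'\<rangle>\<close> for some \<open>y\<close>, and then \<open>T x - x \<otimes> y\<close> is orthogonal to all
  elementary tensors.\<close>

lemma Hom_rep_into_tensor:
  fixes \<rho> :: "('g, 'v::chilbert_space) rep" and R :: "('g, 'f::chilbert_space) rep"
    and Y :: "'y::chilbert_space set"
  assumes irr: "irreducible_rep K \<rho>" and R: "unitary_rep K R" and Y: "closed_csubspace Y"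
    and \<sigma>: "hilbert_tensor_product (rep_space \<rho>) Y I \<sigma>"
    and equiv: "\<And>g x y. g \<in> carrier K \<Longrightarrow> x \<in> rep_space \<rho> \<Longrightarrow> y \<in> Y \<Longrightarrow>
      rep_act R g (\<sigma> x y) = \<sigma> (rep_act \<rho> g x) y"
    and I: "I \<subseteq> rep_space R"
    and T: "T \<in> Hom_rep K \<rho> R" and T_I: "T ` rep_space \<rho> \<subseteq> I"
  shows "\<exists>y\<in>Y. \<forall>x\<in>rep_space \<rho>. T x = \<sigma> x y"
proof -
  let ?X = "rep_space \<rho>"
  note \<rho> = unitary_repD[OF irreducible_repD(1)[OF irr]] and R' = unitary_repD[OF R] and T' = Hom_repD[OF T]
  note \<sigma>' = hilbert_tensor_productD[OF \<sigma>]
  obtain k where k: "0 \<le> k" "\<And>x. x \<in> ?X \<Longrightarrow> norm (T x) \<le> k * norm x"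
    using Hom_rep_bounded[OF T \<rho>(1)] by blast
  have "\<exists>c. \<forall>x\<in>?X. \<forall>x'\<in>?X. cinner (T x) (\<sigma> x' y) = c * cinner x x'" if y: "y \<in> Y" for y
  proof (rule schur_form[OF irr, where K = "k * norm y"])
    fix x x' assume x: "x \<in> ?X" "x' \<in> ?X"
    have "cmod (cinner (T x) (\<sigma> x' y)) \<le> norm (T x) * norm (\<sigma> x' y)" by (rule norm_cinner_le)
    also have "\<dots> \<le> (k * norm x) * (norm x' * norm y)"
      using k x y by (intro mult_mono) (auto simp: norm_tensor[OF \<sigma>])
    finally show "cmod (cinner (T x) (\<sigma> x' y)) \<le> k * norm y * norm x * norm x'" by (simp add: ac_simps)
  next
    fix g x x' assume g: "g \<in> carrier K" and x: "x \<in> ?X" "x' \<in> ?X"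
    have "\<sigma> x' y \<in> rep_space R" using \<sigma>'(7)[OF x(2) y] I by blast
    then show "cinner (T (rep_act \<rho> g x)) (\<sigma> (rep_act \<rho> g x') y) = cinner (T x) (\<sigma> x' y)"
      using R'(6)[OF g T'(1)[OF x(1)]] by (simp add: T' g x y equiv[symmetric])
  qed (simp_all add: T' \<sigma>' y cinner_add_left cinner_add_right cinner_scaleC_left cinner_scaleC_right)
  then obtain c where c: "\<And>y x x'. y \<in> Y \<Longrightarrow> x \<in> ?X \<Longrightarrow> x' \<in> ?X \<Longrightarrow> cinner (T x) (\<sigma> x' y) = c y * cinner x x'"
    by metis
  obtain x\<^sub>0 where x\<^sub>0: "x\<^sub>0 \<in> ?X" "x\<^sub>0 \<noteq> 0" using irreducible_repD(2)[OF irr] by blast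
  define q where "q = complex_of_real ((norm x\<^sub>0)\<^sup>2)"
  have q: "q \<noteq> 0" using x\<^sub>0(2) by (simp add: q_def)
  have cnj_c: "cnj (c y) = cinner (\<sigma> x\<^sub>0 y) (T x\<^sub>0) / q" if "y \<in> Y" for y
  proof -
    have "cinner (\<sigma> x\<^sub>0 y) (T x\<^sub>0) = cnj (c y * q)"
      using cinner_commute[of "\<sigma> x\<^sub>0 y" "T x\<^sub>0"] c[OF that x\<^sub>0(1) x\<^sub>0(1)] by (simp add: cinner_self q_def)
    then show ?thesis using q by (simp add: q_def)
  qed
  have "\<exists>y\<in>Y. \<forall>y'\<in>Y. cnj (c y') = cinner y' y"
  proof (rule complex_riesz[OF Y, where K = "norm x\<^sub>0 * norm (T x\<^sub>0) / cmod q"])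
    fix y assume y: "y \<in> Y"
    have "cmod (cinner (\<sigma> x\<^sub>0 y) (T x\<^sub>0)) \<le> norm x\<^sub>0 * norm y * norm (T x\<^sub>0)"
      using norm_cinner_le[of "\<sigma> x\<^sub>0 y" "T x\<^sub>0"] by (simp add: norm_tensor[OF \<sigma> x\<^sub>0(1) y])
    then show "cmod (cnj (c y)) \<le> norm x\<^sub>0 * norm (T x\<^sub>0) / cmod q * norm y"
      unfolding cnj_c[OF y] norm_divide by (simp add: divide_right_mono ac_simps)
  qed (simp_all add: cnj_c closed_csubspaceD[OF Y] \<sigma>' x\<^sub>0 cinner_add_left cinner_scaleC_left add_divide_distrib)
  then obtain y where y: "y \<in> Y" "\<And>y'. y' \<in> Y \<Longrightarrow> c y' = cinner y y'"
    by (metis cinner_commute complex_cnj_cnj)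
  have "T x = \<sigma> x y" if x: "x \<in> ?X" for x
  proof -
    let ?u = "T x - \<sigma> x y"
    have "cinner (\<sigma> x' y') ?u = 0" if "x' \<in> ?X" "y' \<in> Y" for x' y'
    proof -
      have "cinner ?u (\<sigma> x' y') = 0"
        using that x y by (simp add: cinner_diff_left c \<sigma>'(5))
      then show ?thesis using cinner_commute[of "\<sigma> x' y'" ?u] by simp
    qed
    moreover have "closed_csubspace I"
      by (subst \<sigma>'(6)) (rule closed_csubspace_closure_cspan)
    then have "?u \<in> I"
      using T_I x \<sigma>'(7)[OF x y(1)] by (intro closed_csubspaceD(6)) auto
    then have "?u \<in> closure (cspan {\<sigma> x y | x y. x \<in> ?X \<and> y \<in> Y})"
      by (rule back_subst[of "\<lambda>I. ?u \<in> I"]) (rule \<sigma>'(6))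
    ultimately have "cinner ?u ?u = 0"
      by (intro cinner_eq_0_closure_cspan[of "{\<sigma> x y | x y. x \<in> ?X \<and> y \<in> Y}" ?u ?u]) blast
    then show ?thesis by (simp add: cinner_self)
  qed
  with y(1) show ?thesis by blast
qed

section \<open>Transfer of intertwining maps between dual pairs\<close>

text \<open>One half of the correspondence. Read \<open>\<sigma>\<close> as \<open>mu \<otimes> mu'\<close> and \<open>\<tau>\<close> as \<open>lam \<otimes> lam'\<close>, both inside the same
  Hilbert space; \<open>K\<close> acts on the first factors and \<open>L\<close> on the second ones. Exchanging the roles of
  \<open>K\<close> and \<open>L\<close>, of \<open>mu\<close> and \<open>lam'\<close>, and of \<open>mu'\<close> and \<open>lam\<close> gives the other half. The maps
  \<open>x \<mapsto> \<tau> (T x) w\<close> take their values in the isotypic component of \<open>mu\<close>, which is why \<open>\<sigma>\<close> has to fill it.\<close>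

lemma Hom_rep_transfer:
  fixes mu :: "('k, 'c::chilbert_space) rep" and mu' :: "('l, 'd::chilbert_space) rep"
    and lam :: "('k, 'a::chilbert_space) rep" and lam' :: "('l, 'b::chilbert_space) rep"
    and R :: "('k, 'f::chilbert_space) rep" and R' :: "('l, 'f) rep"
  assumes mu: "irreducible_rep K mu" and R: "unitary_rep K R"
    and mu': "closed_csubspace (rep_space mu')"
    and mu'_act: "\<And>g y. g \<in> carrier L \<Longrightarrow> y \<in> rep_space mu' \<Longrightarrow> rep_act mu' g y \<in> rep_space mu'"
    and lam': "closed_csubspace (rep_space lam')"
    and lam'_act: "\<And>g w. g \<in> carrier L \<Longrightarrow> w \<in> rep_space lam' \<Longrightarrow> rep_act lam' g w \<in> rep_space lam'"
    and \<sigma>: "hilbert_tensor_product (rep_space mu) (rep_space mu') (isotypic_component K R mu) \<sigma>"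
    and \<sigma>_K: "\<And>g x y. g \<in> carrier K \<Longrightarrow> x \<in> rep_space mu \<Longrightarrow> y \<in> rep_space mu' \<Longrightarrow>
      rep_act R g (\<sigma> x y) = \<sigma> (rep_act mu g x) y"
    and \<sigma>_L: "\<And>g x y. g \<in> carrier L \<Longrightarrow> x \<in> rep_space mu \<Longrightarrow> y \<in> rep_space mu' \<Longrightarrow>
      rep_act R' g (\<sigma> x y) = \<sigma> x (rep_act mu' g y)"
    and \<tau>: "hilbert_tensor_product (rep_space lam) (rep_space lam') J \<tau>"
    and \<tau>_K: "\<And>g v w. g \<in> carrier K \<Longrightarrow> v \<in> rep_space lam \<Longrightarrow> w \<in> rep_space lam' \<Longrightarrow>
      rep_act R g (\<tau> v w) = \<tau> (rep_act lam g v) w"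
    and \<tau>_L: "\<And>g v w. g \<in> carrier L \<Longrightarrow> v \<in> rep_space lam \<Longrightarrow> w \<in> rep_space lam' \<Longrightarrow>
      rep_act R' g (\<tau> v w) = \<tau> v (rep_act lam' g w)"
    and R_UNIV: "rep_space R = UNIV"
    and T: "T \<in> Hom_rep K mu lam"
  shows "\<exists>S\<in>Hom_rep L lam' mu'. \<forall>x\<in>rep_space mu. \<forall>w\<in>rep_space lam'. \<tau> (T x) w = \<sigma> x (S w)"
proof -
  let ?X = "rep_space mu" and ?Y = "rep_space mu'" and ?W = "rep_space lam'"
  note X = closed_csubspaceD[OF unitary_repD(1)[OF irreducible_repD(1)[OF mu]]]
  note Y = closed_csubspaceD[OF mu'] and W = closed_csubspaceD[OF lam']
  note mu_act = unitary_repD(2)[OF irreducible_repD(1)[OF mu]]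
  note T' = Hom_repD[OF T] and \<sigma>' = hilbert_tensor_productD[OF \<sigma>] and \<tau>' = hilbert_tensor_productD[OF \<tau>]
  obtain k where k: "0 \<le> k" "\<And>x. x \<in> ?X \<Longrightarrow> norm (T x) \<le> k * norm x"
    using Hom_rep_bounded[OF T unitary_repD(1)[OF irreducible_repD(1)[OF mu]]] by blast
  have "\<exists>y\<in>?Y. \<forall>x\<in>?X. \<tau> (T x) w = \<sigma> x y" if w: "w \<in> ?W" for w
  proof -
    define a where "a x = (if x \<in> ?X then \<tau> (T x) w else 0)" for x
    have lin: "clinear_on ?X a"
      unfolding clinear_on_def a_def using w by (simp add: X T' \<tau>')
    have "norm (a x) \<le> (k * norm w) * norm x" if "x \<in> ?X" for x
      using mult_right_mono[OF k(2)[OF that] norm_ge_zero[of w]] that w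
      by (simp add: a_def norm_tensor[OF \<tau> T'(1)] ac_simps)
    then have "continuous_on ?X a" by (rule continuous_on_if_clinear_on_bounded[OF X(1) lin])
    with lin have a: "a \<in> Hom_rep K mu R"
      unfolding Hom_rep_def using w by (simp add: R_UNIV a_def mu_act T' \<tau>_K)
    show ?thesis
      using Hom_rep_into_tensor[OF mu R mu' \<sigma> \<sigma>_K _ a Hom_rep_image_subset_isotypic[OF mu R a]]
      by (simp add: R_UNIV a_def cong: ball_cong)
  qed
  then obtain s where s: "\<And>w. w \<in> ?W \<Longrightarrow> s w \<in> ?Y" "\<And>w x. w \<in> ?W \<Longrightarrow> x \<in> ?X \<Longrightarrow> \<tau> (T x) w = \<sigma> x (s w)"
    by metis
  define S where "S w = (if w \<in> ?W then s w else 0)" for w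
  have S_Y: "S w \<in> ?Y" and S: "\<tau> (T x) w = \<sigma> x (S w)" if "w \<in> ?W" "x \<in> ?X" for w x
    using s that by (simp_all add: S_def)
  obtain x\<^sub>0 where x\<^sub>0: "x\<^sub>0 \<in> ?X" "x\<^sub>0 \<noteq> 0" using irreducible_repD(2)[OF mu] by blast
  have S_eq: "S w = y" if "w \<in> ?W" "y \<in> ?Y" "\<tau> (T x\<^sub>0) w = \<sigma> x\<^sub>0 y" for w y
    using tensor_cancel_left[OF \<sigma> Y(1) x\<^sub>0 S_Y[OF that(1) x\<^sub>0(1)] that(2)] S[OF that(1) x\<^sub>0(1)] that(3) by simp
  have lin: "clinear_on ?W S"
    unfolding clinear_on_def
    by (auto intro!: S_eq simp: W Y S_Y[OF _ x\<^sub>0(1)] \<sigma>' \<tau>' T' x\<^sub>0(1) S)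
  have "norm (S w) \<le> k * norm w" if w: "w \<in> ?W" for w
  proof -
    have "norm x\<^sub>0 * norm (S w) = norm (T x\<^sub>0) * norm w"
      using arg_cong[OF S[OF w x\<^sub>0(1)], of norm]
      by (simp add: norm_tensor[OF \<tau> T'(1)] norm_tensor[OF \<sigma> x\<^sub>0(1)] x\<^sub>0(1) w S_Y[OF _ x\<^sub>0(1)])
    also have "\<dots> \<le> norm x\<^sub>0 * (k * norm w)"
      using mult_right_mono[OF k(2)[OF x\<^sub>0(1)] norm_ge_zero[of w]] by (simp add: ac_simps)
    finally show ?thesis using x\<^sub>0(2) by simp
  qed
  then have "continuous_on ?W S" by (rule continuous_on_if_clinear_on_bounded[OF W(1) lin])
  moreover have "S (rep_act lam' g w) = rep_act mu' g (S w)" if g: "g \<in> carrier L" and w: "w \<in> ?W" for g w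
  proof (rule S_eq[OF lam'_act[OF g w] mu'_act[OF g S_Y[OF w x\<^sub>0(1)]]])
    show "\<tau> (T x\<^sub>0) (rep_act lam' g w) = \<sigma> x\<^sub>0 (rep_act mu' g (S w))"
      using \<tau>_L[OF g T'(1)[OF x\<^sub>0(1)] w] \<sigma>_L[OF g x\<^sub>0(1) S_Y[OF w x\<^sub>0(1)]] S[OF w x\<^sub>0(1)] by simp
  qed
  ultimately have "S \<in> Hom_rep L lam' mu'"
    using lin S_Y[OF _ x\<^sub>0(1)] by (auto simp: Hom_rep_def S_def)
  with S show ?thesis by blast
qed


section \<open>Dimensions of spaces of intertwining maps\<close>

text \<open>The target is a representation of a group \<open>G\<close> that may be larger than \<open>K\<close>, because the multiplicities are those of
  restrictions.\<close>

lemma csubspace_Hom_rep: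
  fixes \<rho> :: "('k, 'v::chilbert_space) rep" and \<sigma> :: "('k, 'w::chilbert_space) rep"
  assumes \<sigma>: "unitary_rep G \<sigma>" and K: "carrier K \<subseteq> carrier G"
  shows "csubspace (Hom_rep K \<rho> \<sigma>)"
proof -
  note \<sigma>' = unitary_repD[OF \<sigma>]
  note S = closed_csubspaceD[OF \<sigma>'(1)]
  have act_0: "rep_act \<sigma> g 0 = 0" if "g \<in> carrier K" for g
    using \<sigma>'(5)[of g 0 0] S(3) K that by auto
  show ?thesis
  proof (rule complex_vector.subspaceI)
    show "0 \<in> Hom_rep K \<rho> \<sigma>"
      by (auto simp: Hom_rep_def clinear_on_def S act_0)
  next
    fix T T' assume "T \<in> Hom_rep K \<rho> \<sigma>" "T' \<in> Hom_rep K \<rho> \<sigma>"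
    note T = Hom_repD[OF this(1)] and T' = Hom_repD[OF this(2)]
    have "continuous_on (rep_space \<rho>) (\<lambda>x. T x + T' x)"
      using T(3) T'(3) by (rule continuous_on_add)
    then show "T + T' \<in> Hom_rep K \<rho> \<sigma>"
      using K by (auto simp: Hom_rep_def clinear_on_def plus_fun_def S T T' \<sigma>' scaleC_add_right subset_iff)
  next
    fix c T assume "T \<in> Hom_rep K \<rho> \<sigma>"
    note T = Hom_repD[OF this]
    have "continuous_on (rep_space \<rho>) (\<lambda>x. c *\<^sub>C T x)"
      by (rule bounded_linear.continuous_on[OF bounded_linear_scaleC T(3)])
    then show "c *\<^sub>C T \<in> Hom_rep K \<rho> \<sigma>"
      using K by (auto simp: Hom_rep_def clinear_on_def scaleC_fun_def S T \<sigma>' scaleC_add_right subset_iff mult.commute)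
  qed
qed

lemma cdim_eq_card_basis:
  assumes S: "csubspace S" and B: "B \<subseteq> S" "\<not> cdependent B" "S \<subseteq> cspan B"
  shows "cdim S =o |B|"
proof -
  let ?P = "\<lambda>B. B \<subseteq> S \<and> \<not> cdependent B \<and> S \<subseteq> cspan B"
  have *: "cspan B = S" if "?P B" for B
    using that complex_vector.span_minimal[OF _ S] by blast
  have "?P (SOME B. ?P B)" by (rule someI[of ?P B]) (use B in blast)
  then have "\<exists>f. bij_betw f (SOME B. ?P B) B"
    using B * by (intro complex_vector.bij_if_span_eq_span_bases) blast+
  then show ?thesis unfolding cdim_def by (simp add: card_of_ordIso)
qed

text \<open>The map is linear on the subspace only. It agrees there with the linear map \<open>f\<close> on the whole space that extends
  its values on a basis, and \<open>f\<close> carries this basis to a basis of the image.\<close>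

lemma cdim_eq_if_linear_bij:
  fixes S :: "'a::complex_vector set" and S' :: "'b::complex_vector set"
  assumes S: "csubspace S" and S': "csubspace S'"
    and lin: "clinear_on S \<Phi>" and bij: "bij_betw \<Phi> S S'"
  shows "cdim S =o cdim S'"
proof -
  interpret pair: vector_space_pair "scaleC :: complex \<Rightarrow> 'a \<Rightarrow> 'a" "scaleC :: complex \<Rightarrow> 'b \<Rightarrow> 'b"
    by unfold_locales
  obtain B where B: "B \<subseteq> S" "\<not> cdependent B" "S \<subseteq> cspan B"
    using complex_vector.maximal_independent_subset[of S] by metis
  have span_B: "cspan B = S" using B complex_vector.span_minimal[OF B(1) S] by blast
  obtain f where f: "Vector_Spaces.linear scaleC scaleC f" "\<forall>b\<in>B. f b = \<Phi> b"
    using pair.linear_independent_extend[folded cdependent_raw_def, OF B(2)] by blast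
  interpret f: Vector_Spaces.linear scaleC scaleC f by (rule f(1))
  have f_\<Phi>: "f x = \<Phi> x" if "x \<in> S" for x
  proof -
    have "csubspace {x \<in> S. f x = \<Phi> x}"
      using clinear_on_0[OF lin complex_vector.subspace_0[OF S]] lin
      by (intro complex_vector.subspaceI)
        (auto simp: f.zero f.add f.scale clinear_on_def complex_vector.subspace_0[OF S]
          complex_vector.subspace_add[OF S] complex_vector.subspace_scale[OF S])
    then have "cspan B \<subseteq> {x \<in> S. f x = \<Phi> x}"
      using f(2) B(1) by (intro complex_vector.span_minimal) auto
    with that span_B show ?thesis by blast
  qed
  have inj: "inj_on f S" using bij f_\<Phi> by (auto simp: bij_betw_def inj_on_def)
  have image: "f ` S = S'" using bij f_\<Phi> by (auto simp: bij_betw_def)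
  have "\<not> cdependent (f ` B)"
    using f.independent_injective_image[folded cdependent_raw_def cspan_raw_def, OF B(2)] inj span_B by simp
  moreover have "cspan (f ` B) = S'" using f.span_image[folded cspan_raw_def, of B] span_B image by simp
  ultimately have dim': "cdim S' =o |f ` B|"
    using complex_vector.span_superset[of "f ` B"] by (intro cdim_eq_card_basis[OF S']) auto
  have card_B: "|B| =o |f ` B|"
    by (rule card_of_ordIsoI[of f]) (auto intro: inj_on_imp_bij_betw inj_on_subset[OF inj B(1)])
  show ?thesis
    by (rule ordIso_transitive[OF ordIso_transitive[OF cdim_eq_card_basis[OF S B] card_B] ordIso_symmetric[OF dim']])
qed

text \<open>The relation \<open>Q T S\<close> is total on both sides by \<open>Hom_rep_transfer\<close>, used once for each of the two groups,
  and it is one-to-one because a nonzero vector can be cancelled from an elementary tensor. Being bilinear, the tensor products make the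
  resulting bijection linear.\<close>

lemma cdim_Hom_rep_eq:
  fixes mu :: "('k, 'c::chilbert_space) rep" and mu' :: "('l, 'd::chilbert_space) rep"
    and lam :: "('k, 'a::chilbert_space) rep" and lam' :: "('l, 'b::chilbert_space) rep"
    and R :: "('k, 'f::chilbert_space) rep" and R' :: "('l, 'f) rep"
  assumes mu: "irreducible_rep K mu" and lam': "irreducible_rep L lam'"
    and mu': "unitary_rep L' mu'" "carrier L \<subseteq> carrier L'"
    and lam: "unitary_rep K' lam" "carrier K \<subseteq> carrier K'"
    and R: "unitary_rep K R" "rep_space R = UNIV" and R': "unitary_rep L R'" "rep_space R' = UNIV"
    and \<sigma>: "hilbert_tensor_product (rep_space mu) (rep_space mu') (isotypic_component K R mu) \<sigma>"
    and \<sigma>_K: "\<And>g x y. g \<in> carrier K \<Longrightarrow> x \<in> rep_space mu \<Longrightarrow> y \<in> rep_space mu' \<Longrightarrow>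
      rep_act R g (\<sigma> x y) = \<sigma> (rep_act mu g x) y"
    and \<sigma>_L: "\<And>g x y. g \<in> carrier L \<Longrightarrow> x \<in> rep_space mu \<Longrightarrow> y \<in> rep_space mu' \<Longrightarrow>
      rep_act R' g (\<sigma> x y) = \<sigma> x (rep_act mu' g y)"
    and \<tau>: "hilbert_tensor_product (rep_space lam) (rep_space lam') (isotypic_component L R' lam') \<tau>"
    and \<tau>_K: "\<And>g v w. g \<in> carrier K \<Longrightarrow> v \<in> rep_space lam \<Longrightarrow> w \<in> rep_space lam' \<Longrightarrow>
      rep_act R g (\<tau> v w) = \<tau> (rep_act lam g v) w"
    and \<tau>_L: "\<And>g v w. g \<in> carrier L \<Longrightarrow> v \<in> rep_space lam \<Longrightarrow> w \<in> rep_space lam' \<Longrightarrow>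
      rep_act R' g (\<tau> v w) = \<tau> v (rep_act lam' g w)"
  shows "cdim (Hom_rep K mu lam) =o cdim (Hom_rep L lam' mu')"
proof -
  let ?H = "Hom_rep K mu lam" and ?H' = "Hom_rep L lam' mu'"
  define Q where "Q T S \<longleftrightarrow> (\<forall>x\<in>rep_space mu. \<forall>w\<in>rep_space lam'. \<tau> (T x) w = \<sigma> x (S w))" for T S
  note unitary = irreducible_repD(1)[OF mu] irreducible_repD(1)[OF lam']
  note \<sigma>' = hilbert_tensor_productD[OF \<sigma>] and \<tau>' = hilbert_tensor_productD[OF \<tau>]
  note lam_D = unitary_repD[OF lam(1)] and mu'_D = unitary_repD[OF mu'(1)]
  have total: "\<exists>S\<in>?H'. Q T S" if "T \<in> ?H" for T
    unfolding Q_def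
  proof (rule Hom_rep_transfer[OF mu R(1) mu'_D(1) _ unitary_repD(1,2)[OF unitary(2)] \<sigma> \<sigma>_K \<sigma>_L \<tau> \<tau>_K \<tau>_L R(2) that])
    show "rep_act mu' g y \<in> rep_space mu'" if "g \<in> carrier L" "y \<in> rep_space mu'" for g y
      using mu'_D(2) mu'(2) that by blast
  qed
  have surj: "\<exists>T\<in>?H. Q T S" if "S \<in> ?H'" for S
  proof -
    have "\<exists>T\<in>?H. \<forall>w\<in>rep_space lam'. \<forall>x\<in>rep_space mu. \<sigma> x (S w) = \<tau> (T x) w"
    proof (rule Hom_rep_transfer[OF lam' R'(1) lam_D(1) _ unitary_repD(1,2)[OF unitary(1)]
          hilbert_tensor_product_swap[OF \<tau>] \<tau>_L \<tau>_K hilbert_tensor_product_swap[OF \<sigma>] \<sigma>_L \<sigma>_K R'(2) that])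
      show "rep_act lam g v \<in> rep_space lam" if "g \<in> carrier K" "v \<in> rep_space lam" for g v
        using lam_D(2) lam(2) that by blast
    qed
    then show ?thesis unfolding Q_def by metis
  qed
  have right_unique: "S = S'" if "Q T S" "Q T S'" "S \<in> ?H'" "S' \<in> ?H'" for T S S'
  proof
    fix w
    obtain x where x: "x \<in> rep_space mu" "x \<noteq> 0" using irreducible_repD(2)[OF mu] by blast
    show "S w = S' w"
    proof (cases "w \<in> rep_space lam'")
      case True
      then have "\<sigma> x (S w) = \<sigma> x (S' w)" using that(1,2) x(1) unfolding Q_def by metis
      then show ?thesis
        using tensor_cancel_left[OF \<sigma> closed_csubspaceD(1)[OF mu'_D(1)] x] Hom_repD(1) that(3,4) True by metis
    next
      case False
      then show ?thesis using Hom_repD(7)[OF that(3)] Hom_repD(7)[OF that(4)] by simp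
    qed
  qed
  have left_unique: "T = T'" if "Q T S" "Q T' S" "T \<in> ?H" "T' \<in> ?H" for T T' S
  proof
    fix x
    obtain w where w: "w \<in> rep_space lam'" "w \<noteq> 0" using irreducible_repD(2)[OF lam'] by blast
    show "T x = T' x"
    proof (cases "x \<in> rep_space mu")
      case True
      then have "\<tau> (T x) w = \<tau> (T' x) w" using that(1,2) w(1) unfolding Q_def by metis
      then show ?thesis
        using tensor_cancel_left[OF hilbert_tensor_product_swap[OF \<tau>] closed_csubspaceD(1)[OF lam_D(1)] w]
          Hom_repD(1) that(3,4) True by metis
    next
      case False
      then show ?thesis using Hom_repD(7)[OF that(3)] Hom_repD(7)[OF that(4)] by simp
    qed
  qed
  have sub: "csubspace ?H" "csubspace ?H'"
    by (rule csubspace_Hom_rep[OF lam], rule csubspace_Hom_rep[OF mu'])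
  obtain \<Phi> where \<Phi>: "\<And>T. T \<in> ?H \<Longrightarrow> \<Phi> T \<in> ?H'" "\<And>T. T \<in> ?H \<Longrightarrow> Q T (\<Phi> T)"
    using total by metis
  have \<Phi>_eq: "\<Phi> T = S" if "T \<in> ?H" "S \<in> ?H'" "Q T S" for T S
    using right_unique[OF \<Phi>(2)[OF that(1)] that(3) \<Phi>(1)[OF that(1)] that(2)] .
  have "clinear_on ?H \<Phi>"
    unfolding clinear_on_def
  proof (intro conjI ballI allI)
    fix T T' assume T: "T \<in> ?H" "T' \<in> ?H"
    show "\<Phi> (T + T') = \<Phi> T + \<Phi> T'"
    proof (rule \<Phi>_eq)
      show "Q (T + T') (\<Phi> T + \<Phi> T')"
        using \<Phi>(2)[OF T(1)] \<Phi>(2)[OF T(2)]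
        by (simp add: Q_def plus_fun_def \<sigma>' \<tau>' Hom_repD(1)[OF T(1)] Hom_repD(1)[OF T(2)]
            Hom_repD(1)[OF \<Phi>(1)[OF T(1)]] Hom_repD(1)[OF \<Phi>(1)[OF T(2)]])
    qed (intro complex_vector.subspace_add sub \<Phi>(1) T)+
  next
    fix c T assume T: "T \<in> ?H"
    show "\<Phi> (c *\<^sub>C T) = c *\<^sub>C \<Phi> T"
    proof (rule \<Phi>_eq)
      show "Q (c *\<^sub>C T) (c *\<^sub>C \<Phi> T)"
        using \<Phi>(2)[OF T]
        by (simp add: Q_def scaleC_fun_def \<sigma>' \<tau>' Hom_repD(1)[OF T] Hom_repD(1)[OF \<Phi>(1)[OF T]])
    qed (intro complex_vector.subspace_scale sub \<Phi>(1) T)+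
  qed
  moreover have "bij_betw \<Phi> ?H ?H'"
    unfolding bij_betw_def
  proof
    show "inj_on \<Phi> ?H"
    proof (rule inj_onI)
      fix T T' assume T: "T \<in> ?H" "T' \<in> ?H" "\<Phi> T = \<Phi> T'"
      show "T = T'" using left_unique[OF \<Phi>(2)[OF T(1)] _ T(1,2)] \<Phi>(2)[OF T(2)] T(3) by simp
    qed
    show "\<Phi> ` ?H = ?H'" using \<Phi>(1) \<Phi>_eq surj by blast
  qed
  ultimately show ?thesis by (rule cdim_eq_if_linear_bij[OF sub])
qed

section \<open>Dual representations and seesaw pairs\<close>

lemma dual_representationsD:
  assumes "dual_representations G G' R R' \<Lambda> V W"
  shows "rep_space R = rep_space R'" and "unitary_rep G R" and "unitary_rep G' R'"
    and "\<forall>l\<in>\<Lambda>. irreducible_rep G (V l) \<and> irreducible_rep G' (W l)"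
    and "\<forall>l\<in>\<Lambda>. isotypic_component G R (V l) = isotypic_component G' R' (W l)"
    and "multiplicity_free_decomposition G' G R' R (rep_space R) \<Lambda> (\<lambda>l. isotypic_component G R (V l))"
    and "\<forall>l\<in>\<Lambda>. \<exists>\<tau>.
      hilbert_tensor_product (rep_space (V l)) (rep_space (W l)) (isotypic_component G R (V l)) \<tau> \<and>
      (\<forall>g\<in>carrier G. \<forall>g'\<in>carrier G'. \<forall>v\<in>rep_space (V l). \<forall>w\<in>rep_space (W l).
        rep_act R' g' (rep_act R g (\<tau> v w)) = \<tau> (rep_act (V l) g v) (rep_act (W l) g' w))"
  using assms unfolding dual_representations_def by - (elim conjE, assumption)+

text \<open>The models \<open>V l\<close> and \<open>W l\<close> of a signature may be exchanged for any equivalent representations by composing the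
  tensor product with the unitary equivalences. Putting one of the two group elements equal to the identity separates the
  joint equivariance into an equivariance in each factor.\<close>

lemma dual_representations_tensor:
  fixes lam :: "('g, 'a::chilbert_space) rep" and lam' :: "('h, 'b::chilbert_space) rep"
    and R :: "('g, 'f::chilbert_space) rep" and R' :: "('h, 'f) rep"
  assumes one: "\<one>\<^bsub>G\<^esub> \<in> carrier G" "\<one>\<^bsub>G'\<^esub> \<in> carrier G'"
    and dual: "dual_representations G G' R R' \<Lambda> V W" and UNIV: "rep_space R = UNIV" and l: "l \<in> \<Lambda>"
    and lam: "unitary_rep G lam" "rep_equiv G lam (V l)"
    and lam': "unitary_rep G' lam'" "rep_equiv G' lam' (W l)"
  shows "isotypic_component G R lam = isotypic_component G' R' lam'"
    and "\<exists>\<tau>. hilbert_tensor_product (rep_space lam) (rep_space lam') (isotypic_component G R lam) \<tau> \<and>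
      (\<forall>g\<in>carrier G. \<forall>v\<in>rep_space lam. \<forall>w\<in>rep_space lam'.
        rep_act R g (\<tau> v w) = \<tau> (rep_act lam g v) w) \<and>
      (\<forall>g\<in>carrier G'. \<forall>v\<in>rep_space lam. \<forall>w\<in>rep_space lam'.
        rep_act R' g (\<tau> v w) = \<tau> v (rep_act lam' g w))"
proof -
  note D = dual_representationsD[OF dual]
  note R = D(2,3) D(1)[unfolded UNIV, symmetric]
  note irr = D(4)[rule_format, OF l, THEN conjunct1] D(4)[rule_format, OF l, THEN conjunct2]
  note iso = D(5)[rule_format, OF l]
  from D(7) l have "\<exists>t. hilbert_tensor_product (rep_space (V l)) (rep_space (W l)) (isotypic_component G R (V l)) t \<and>
      (\<forall>g\<in>carrier G. \<forall>g'\<in>carrier G'. \<forall>v\<in>rep_space (V l). \<forall>w\<in>rep_space (W l).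
        rep_act R' g' (rep_act R g (t v w)) = t (rep_act (V l) g v) (rep_act (W l) g' w))"
    by (rule bspec)
  then obtain t where t: "hilbert_tensor_product (rep_space (V l)) (rep_space (W l)) (isotypic_component G R (V l)) t"
    "\<And>g g' v w. g \<in> carrier G \<Longrightarrow> g' \<in> carrier G' \<Longrightarrow> v \<in> rep_space (V l) \<Longrightarrow> w \<in> rep_space (W l) \<Longrightarrow>
      rep_act R' g' (rep_act R g (t v w)) = t (rep_act (V l) g v) (rep_act (W l) g' w)"
    by blast
  obtain U where U: "unitary_map (rep_space lam) (rep_space (V l)) U"
    "\<And>g v. g \<in> carrier G \<Longrightarrow> v \<in> rep_space lam \<Longrightarrow> U (rep_act lam g v) = rep_act (V l) g (U v)"
    using lam(2) unfolding rep_equiv_def by blast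
  obtain U' where U': "unitary_map (rep_space lam') (rep_space (W l)) U'"
    "\<And>g v. g \<in> carrier G' \<Longrightarrow> v \<in> rep_space lam' \<Longrightarrow> U' (rep_act lam' g v) = rep_act (W l) g (U' v)"
    using lam'(2) unfolding rep_equiv_def by blast
  have in_V: "U v \<in> rep_space (V l)" if "v \<in> rep_space lam" for v
    using U(1) that by (auto simp: unitary_map_def bij_betw_def)
  have in_W: "U' w \<in> rep_space (W l)" if "w \<in> rep_space lam'" for w
    using U'(1) that by (auto simp: unitary_map_def bij_betw_def)
  note one_V = unitary_repD(7)[OF irreducible_repD(1)[OF irr(1)]]
    and one_W = unitary_repD(7)[OF irreducible_repD(1)[OF irr(2)]]
  note one_R = unitary_repD(7)[OF R(1), unfolded UNIV, OF UNIV_I] and one_R' = unitary_repD(7)[OF R(2), unfolded R(3), OF UNIV_I]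
  let ?\<tau> = "\<lambda>v w. t (U v) (U' w)"
  have iso_lam: "isotypic_component G R lam = isotypic_component G R (V l)"
    by (rule isotypic_component_cong[OF lam])
  also note iso
  also have "isotypic_component G' R' (W l) = isotypic_component G' R' lam'"
    by (rule isotypic_component_cong[OF lam', symmetric])
  finally show "isotypic_component G R lam = isotypic_component G' R' lam'" .
  show "\<exists>\<tau>. hilbert_tensor_product (rep_space lam) (rep_space lam') (isotypic_component G R lam) \<tau> \<and>
      (\<forall>g\<in>carrier G. \<forall>v\<in>rep_space lam. \<forall>w\<in>rep_space lam'.
        rep_act R g (\<tau> v w) = \<tau> (rep_act lam g v) w) \<and>
      (\<forall>g\<in>carrier G'. \<forall>v\<in>rep_space lam. \<forall>w\<in>rep_space lam'.
        rep_act R' g (\<tau> v w) = \<tau> v (rep_act lam' g w))"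
  proof (intro exI[of _ ?\<tau>] conjI ballI)
    show "hilbert_tensor_product (rep_space lam) (rep_space lam') (isotypic_component G R lam) ?\<tau>"
      unfolding iso_lam by (rule hilbert_tensor_product_unitary[OF t(1) U(1) U'(1)])
    show "rep_act R g (?\<tau> v w) = ?\<tau> (rep_act lam g v) w"
      if "g \<in> carrier G" "v \<in> rep_space lam" "w \<in> rep_space lam'" for g v w
      using t(2)[OF that(1) one(2) in_V[OF that(2)] in_W[OF that(3)]] U(2)[OF that(1,2)]
      by (simp add: one_R' one_W in_W[OF that(3)])
    show "rep_act R' g (?\<tau> v w) = ?\<tau> v (rep_act lam' g w)"
      if "g \<in> carrier G'" "v \<in> rep_space lam" "w \<in> rep_space lam'" for g v w
      using t(2)[OF one(1) that(1) in_V[OF that(2)] in_W[OF that(3)]] U'(2)[OF that(1,3)]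
      by (simp add: one_R one_V in_V[OF that(2)])
  qed
qed

lemma one_in_inductive_limit:
  assumes "compact_group_chain k\<^sub>0 G"
  shows "\<one>\<^bsub>inductive_limit k\<^sub>0 G\<^esub> \<in> carrier (inductive_limit k\<^sub>0 G)"
proof -
  have "subgroup (G k\<^sub>0) (GL k\<^sub>0)" using assms by (simp add: compact_group_chain_def)
  then have "imat_one \<in> G k\<^sub>0" using subgroup.one_closed by (fastforce simp: GL_def)
  then show ?thesis by (auto simp: inductive_limit_def)
qed

theorem theorem3p2:
  fixes n k\<^sub>0 :: nat
    and \<iota> :: "nat \<Rightarrow> (complex mat \<Rightarrow> complex) \<Rightarrow> 'f::chilbert_space"
    and G H :: "nat \<Rightarrow> imat set"
    and G_inf H_inf :: "imat topgroup"
    and G' H' :: "'h topgroup"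
    and R_G R_H :: "(imat, 'f) rep"
    and R'_G R'_H :: "('h, 'f) rep"
    and \<Lambda> :: "'l set"
    and V :: "'l \<Rightarrow> (imat, 'v::chilbert_space) rep"
    and W :: "'l \<Rightarrow> ('h, 'w::chilbert_space) rep"
    and \<M> :: "'m set"
    and X :: "'m \<Rightarrow> (imat, 'x::chilbert_space) rep"
    and Y :: "'m \<Rightarrow> ('h, 'y::chilbert_space) rep"
  assumes "n \<ge> 1"
    and "fock_completion n \<iota>"
    and "compact_group_chain k\<^sub>0 G" and "G_inf = inductive_limit k\<^sub>0 G"
    and "topological_group G'"
    and "rep_space R_G = UNIV"
    and "dual_representations G_inf G' R_G R'_G \<Lambda> V W"
    and "compact_group_chain k\<^sub>0 H" and "H_inf = inductive_limit k\<^sub>0 H"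
    and "\<forall>k\<ge>k\<^sub>0. H k \<subseteq> G k"
    and "is_restriction H_inf R_H R_G"
    and "topological_group H'" and "topological_subgroup G' H'"
    and "dual_representations H_inf H' R_H R'_H \<M> X Y"
    and "is_restriction G' R'_G R'_H"
  shows
    "multiplicity_free_decomposition G' G_inf R'_G R_G UNIV \<Lambda>
       (\<lambda>l. isotypic_component G_inf R_G (V l)) \<and>
     (\<forall>l\<in>\<Lambda>. isotypic_component G_inf R_G (V l) = isotypic_component G' R'_G (W l)) \<and>
     multiplicity_free_decomposition H' H_inf R'_H R_H UNIV \<M>
       (\<lambda>m. isotypic_component H_inf R_H (X m)) \<and>
     (\<forall>m\<in>\<M>. isotypic_component H_inf R_H (X m) = isotypic_component H' R'_H (Y m)) \<and>
     (\<forall>l\<in>\<Lambda>. \<forall>m\<in>\<M>.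
       \<forall>(lam_G :: (imat, 'a::chilbert_space) rep) (lam'_G :: ('h, 'b::chilbert_space) rep)
        (mu_H :: (imat, 'c::chilbert_space) rep) (mu'_H :: ('h, 'd::chilbert_space) rep).
         irreducible_rep G_inf lam_G \<and> rep_equiv G_inf lam_G (V l) \<and>
         irreducible_rep G' lam'_G \<and> rep_equiv G' lam'_G (W l) \<and>
         irreducible_rep H_inf mu_H \<and> rep_equiv H_inf mu_H (X m) \<and>
         irreducible_rep H' mu'_H \<and> rep_equiv H' mu'_H (Y m) \<longrightarrow>
         cdim (Hom_rep H_inf mu_H lam_G) =o cdim (Hom_rep G' lam'_G mu'_H))"
proof -
  have UNIV: "rep_space R_G = UNIV" "rep_space R_H = UNIV" "rep_space R'_G = UNIV"
    using assms(6,11) dual_representationsD(1)[OF assms(7)] by (simp_all add: is_restriction_def)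
  have R'_H_UNIV: "rep_space R'_H = UNIV"
    using assms(15) UNIV(3) by (simp add: is_restriction_def)
  have R_H: "rep_act R_H g x = rep_act R_G g x" if "g \<in> carrier H_inf" for g x
    using assms(11) UNIV(1) that by (simp add: is_restriction_def)
  have R'_G: "rep_act R'_G g x = rep_act R'_H g x" if "g \<in> carrier G'" for g x
    using assms(15) R'_H_UNIV that by (simp add: is_restriction_def)
  note unitary = dual_representationsD(2)[OF assms(14)] dual_representationsD(3)[OF assms(7)]
  have H_G: "carrier H_inf \<subseteq> carrier G_inf"
    using assms(10) unfolding assms(4,9) by (auto simp: inductive_limit_def)
  have "subgroup (carrier G') H'" using assms(13) by (simp add: topological_subgroup_def)
  then have G'_H': "carrier G' \<subseteq> carrier H'" by (rule subgroup.subset)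
  have one: "\<one>\<^bsub>G_inf\<^esub> \<in> carrier G_inf" "\<one>\<^bsub>H_inf\<^esub> \<in> carrier H_inf"
    using one_in_inductive_limit assms(3,4,8,9) by blast+
  have one': "\<one>\<^bsub>G'\<^esub> \<in> carrier G'" "\<one>\<^bsub>H'\<^esub> \<in> carrier H'"
    using assms(5,12) by (auto simp: topological_group_def intro!: monoid.one_closed group.is_monoid)
  have multiplicity: "\<forall>l\<in>\<Lambda>. \<forall>m\<in>\<M>.
      \<forall>(lam :: (imat, 'a) rep) (lam' :: ('h, 'b) rep) (mu :: (imat, 'c) rep) (mu' :: ('h, 'd) rep).
        irreducible_rep G_inf lam \<and> rep_equiv G_inf lam (V l) \<and>
        irreducible_rep G' lam' \<and> rep_equiv G' lam' (W l) \<and>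
        irreducible_rep H_inf mu \<and> rep_equiv H_inf mu (X m) \<and>
        irreducible_rep H' mu' \<and> rep_equiv H' mu' (Y m) \<longrightarrow>
        cdim (Hom_rep H_inf mu lam) =o cdim (Hom_rep G' lam' mu')"
  proof (intro ballI allI impI, elim conjE)
    fix l m
      and lam :: "(imat, 'a) rep" and lam' :: "('h, 'b) rep"
      and mu :: "(imat, 'c) rep" and mu' :: "('h, 'd) rep"
    assume l: "l \<in> \<Lambda>" and m: "m \<in> \<M>"
      and lam: "irreducible_rep G_inf lam" "rep_equiv G_inf lam (V l)"
      and lam': "irreducible_rep G' lam'" "rep_equiv G' lam' (W l)"
      and mu: "irreducible_rep H_inf mu" "rep_equiv H_inf mu (X m)"
      and mu': "irreducible_rep H' mu'" "rep_equiv H' mu' (Y m)"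
    note lam_u = irreducible_repD(1)[OF lam(1)] and lam'_u = irreducible_repD(1)[OF lam'(1)]
      and mu_u = irreducible_repD(1)[OF mu(1)] and mu'_u = irreducible_repD(1)[OF mu'(1)]
    note G_tensor = dual_representations_tensor[OF one(1) one'(1) assms(7) UNIV(1) l lam_u lam(2) lam'_u lam'(2)]
    note H_tensor = dual_representations_tensor[OF one(2) one'(2) assms(14) UNIV(2) m mu_u mu(2) mu'_u mu'(2)]
    obtain \<tau> where \<tau>: "hilbert_tensor_product (rep_space lam) (rep_space lam') (isotypic_component G_inf R_G lam) \<tau>"
      "\<forall>g\<in>carrier G_inf. \<forall>v\<in>rep_space lam. \<forall>w\<in>rep_space lam'.
        rep_act R_G g (\<tau> v w) = \<tau> (rep_act lam g v) w"
      "\<forall>g\<in>carrier G'. \<forall>v\<in>rep_space lam. \<forall>w\<in>rep_space lam'.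
        rep_act R'_G g (\<tau> v w) = \<tau> v (rep_act lam' g w)"
      using G_tensor(2) by (elim exE conjE)
    obtain \<sigma> where \<sigma>: "hilbert_tensor_product (rep_space mu) (rep_space mu') (isotypic_component H_inf R_H mu) \<sigma>"
      "\<forall>g\<in>carrier H_inf. \<forall>x\<in>rep_space mu. \<forall>y\<in>rep_space mu'.
        rep_act R_H g (\<sigma> x y) = \<sigma> (rep_act mu g x) y"
      "\<forall>g\<in>carrier H'. \<forall>x\<in>rep_space mu. \<forall>y\<in>rep_space mu'.
        rep_act R'_H g (\<sigma> x y) = \<sigma> x (rep_act mu' g y)"
      using H_tensor(2) by (elim exE conjE)
    show "cdim (Hom_rep H_inf mu lam) =o cdim (Hom_rep G' lam' mu')"
    proof (rule cdim_Hom_rep_eq[OF mu(1) lam'(1) mu'_u G'_H' lam_u H_G unitary(1) UNIV(2) unitary(2) UNIV(3) \<sigma>(1)])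
      show "hilbert_tensor_product (rep_space lam) (rep_space lam') (isotypic_component G' R'_G lam') \<tau>"
        using \<tau>(1) unfolding G_tensor(1) .
      show "rep_act R_H g (\<tau> v w) = \<tau> (rep_act lam g v) w"
        if "g \<in> carrier H_inf" "v \<in> rep_space lam" "w \<in> rep_space lam'" for g v w
        using \<tau>(2) H_G that by (simp add: R_H subset_iff)
      show "rep_act R'_G g (\<sigma> x y) = \<sigma> x (rep_act mu' g y)"
        if "g \<in> carrier G'" "x \<in> rep_space mu" "y \<in> rep_space mu'" for g x y
        using \<sigma>(3) G'_H' that by (simp add: R'_G subset_iff)
    qed (simp_all add: \<sigma>(2) \<tau>(3))
  qed
  have "multiplicity_free_decomposition G' G_inf R'_G R_G UNIV \<Lambda>
      (\<lambda>l. isotypic_component G_inf R_G (V l))"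
    using dual_representationsD(6)[OF assms(7)] unfolding UNIV .
  moreover have "multiplicity_free_decomposition H' H_inf R'_H R_H UNIV \<M>
      (\<lambda>m. isotypic_component H_inf R_H (X m))"
    using dual_representationsD(6)[OF assms(14)] unfolding UNIV .
  ultimately show ?thesis
    using dual_representationsD(5)[OF assms(7)] dual_representationsD(5)[OF assms(14)] multiplicity
    by (intro conjI)
qed

end
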